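(* Let $R$ be a commutative profinite ring, $G$ a profinite group, $T$ a compact $R[[G]]$-module finitely generated over $R$, $a,b\ge0$ integers with $n=a+b\ge 2$, and let $(\phi,\theta)$ be a partial defining system, i.e. continuous homomorphisms $\phi\colon G\to\mathrm{U}_{a+1}(R)$, $\theta\colon G\to\mathrm{U}_{b+1}(R)$; write $\alpha_i=\phi_{i,i+1}$ ($1\le i\le a$) and $\beta_i=\theta_{i,i+1}$ ($1\le i\le b$). Let $\kappa'\in Z^1(G,\mathfrak{U}'_{\phi,\theta}(T))$ and let $\rho=\begin{pmatrix}\phi&\kappa'\theta\\0&\theta\end{pmatrix}$ be the associated proper defining system. Then the image of the class of $\kappa'$ under the connecting map $\partial\colon H^1(G,\mathfrak{U}'_{\phi,\theta}(T))\to H^2(G,T)$ of the short exact sequence $0\to T\to\mathfrak{U}_{\phi,\theta}(T)\to\mathfrak{U}'_{\phi,\theta}(T)\to 0$ is the $(n+1)$-fold Massey product $(\alpha_1,\dots,\alpha_a,\kappa'_{a+1,1},\beta_1,\dots,\beta_b)_\rho$.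
   Context: $\mathrm{U}_k(R)$ is the group of $k\times k$ upper-triangular unipotent matrices over $R$. $\mathfrak{U}_{\phi,\theta}(T)$ is the $R$-module $M_{a+1,b+1}(T)$ with continuous $G$-action $g\star X = \phi(g)\cdot (gX)\cdot\theta(g)^{-1}$ ($gX$: $g$ applied entrywise). It contains $T$ as the $R[[G]]$-submodule of matrices zero outside the $(1,b+1)$-entry, and $\mathfrak{U}'_{\phi,\theta}(T)=\mathfrak{U}_{\phi,\theta}(T)/T$. Let $\mathcal{U}=\mathcal{U}_{n+2}(T,a+1)$ be the group of $(n+2)\times(n+2)$ block matrices $\begin{pmatrix}P&X\\0&Q\end{pmatrix}$ with $P\in\mathrm{U}_{a+1}(R)$, $Q\in\mathrm{U}_{b+1}(R)$, $X\in M_{a+1,b+1}(T)$, with usual matrix multiplication (using the $R$-module structure of $T$) and $G$ acting on the entries of $X$ via $T$; let $\mathcal{U}'=\mathcal{U}'_{n+2}(T,a+1)$ be the quotient by the central subgroup of matrices with $P,Q$ the identity and $X$ zero outside its $(1,b+1)$-entry (so its upper-right block lies in $M'_{a+1,b+1}(T)=M_{a+1,b+1}(T)/T$). A proper defining system relative to $(\phi,\theta)$ is a continuous map $\rho\colon G\to\mathcal{U}'$ with $\rho(gh)=\rho(g)\cdot g\rho(h)$ of the form $\begin{pmatrix}\phi&\kappa\\0&\theta\end{pmatrix}$. For such $\rho$ let $\tilde\rho\colon G\to\mathcal{U}$ be the lift with $(1,n+2)$-entry $0$, with entries $\rho_{i,j}$. The Massey product $(\alpha_1,\dots,\alpha_a,\lambda,\beta_1,\dots,\beta_b)_\rho\in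 H^2(G,T)$, where $\lambda=\rho_{a+1,a+2}$, is the class of the $2$-cocycle $(g,h)\mapsto\sum_{i=2}^{n+1}\rho_{1,i}(g)\,g\rho_{i,n+2}(h)$, i.e. the $(1,n+2)$-entry of $\tilde\rho(g)\cdot g\tilde\rho(h)$. *)

theory Defs
  imports
    "HOL-Analysis.T1_Spaces"
    "HOL-Analysis.Product_Topology"
    "HOL-Analysis.Function_Topology"
    "HOL-Algebra.Product_Groups"
    "HOL-Algebra.Module"
begin

section \<open>Topological algebraic structures\<close>

record 'a tgroup = "'a monoid" +
  gtop :: "'a topology"

record 'r tring = "'r ring" +
  rtop :: "'r topology"

text \<open>A group (usually abelian, written multiplicatively as everywhere in HOL-Algebra) with a
  topology and an action of \<open>'g\<close>; used for coefficient modules and for the non-abelian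
  group of block matrices.\<close>

record ('g, 'm) gmod = "'m tgroup" +
  act :: "'g \<Rightarrow> 'm \<Rightarrow> 'm"

record ('g, 'r, 't) rgmod = "('r, 't) module" +
  mtop :: "'t topology"
  mact :: "'g \<Rightarrow> 't \<Rightarrow> 't"

definition profinite_space :: "'a topology \<Rightarrow> bool" where
  "profinite_space X \<longleftrightarrow> compact_space X \<and> Hausdorff_space X \<and>
     (\<forall>S. connectedin X S \<longrightarrow> (\<exists>x. S \<subseteq> {x}))"

definition profinite_group :: "('g, 'c) tgroup_scheme \<Rightarrow> bool" where
  "profinite_group G \<longleftrightarrow>
     Group.group G \<and> topspace (gtop G) = carrier G \<and> profinite_space (gtop G) \<and>
     continuous_map (prod_topology (gtop G) (gtop G)) (gtop G) (\<lambda>(x, y). x \<otimes>\<^bsub>G\<^esub> y) \<and>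
     continuous_map (gtop G) (gtop G) (\<lambda>x. inv\<^bsub>G\<^esub> x)"

definition profinite_cring :: "('r, 'c) tring_scheme \<Rightarrow> bool" where
  "profinite_cring R \<longleftrightarrow>
     cring R \<and> topspace (rtop R) = carrier R \<and> profinite_space (rtop R) \<and>
     continuous_map (prod_topology (rtop R) (rtop R)) (rtop R) (\<lambda>(x, y). x \<oplus>\<^bsub>R\<^esub> y) \<and>
     continuous_map (rtop R) (rtop R) (\<lambda>x. \<ominus>\<^bsub>R\<^esub> x) \<and>
     continuous_map (prod_topology (rtop R) (rtop R)) (rtop R) (\<lambda>(x, y). x \<otimes>\<^bsub>R\<^esub> y)"

text \<open>Compact (Hausdorff) modules over the completed group ring \<open>R[[G]]\<close>, given by the
  actions of \<open>R\<close> and of \<open>G\<close>: since \<open>R[G]\<close> is dense in \<open>R[[G]]\<close>, the module structure is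
  determined by these, and a compact topological \<open>R\<close>-module with a continuous \<open>R\<close>-linear action
  of \<open>G\<close> is an inverse limit of finite \<open>R[G]\<close>-modules with continuous actions, hence an
  \<open>R[[G]]\<close>-module.\<close>

definition compact_RG_module ::
  "('g, 'c) tgroup_scheme \<Rightarrow> ('r, 'd) tring_scheme \<Rightarrow> ('g, 'r, 't, 'e) rgmod_scheme \<Rightarrow> bool" where
  "compact_RG_module G R T \<longleftrightarrow>
     Module.module R T \<and> topspace (mtop T) = carrier T \<and>
     compact_space (mtop T) \<and> Hausdorff_space (mtop T) \<and>
     continuous_map (prod_topology (mtop T) (mtop T)) (mtop T) (\<lambda>(x, y). x \<oplus>\<^bsub>T\<^esub> y) \<and>
     continuous_map (mtop T) (mtop T) (\<lambda>x. \<ominus>\<^bsub>T\<^esub> x) \<and>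
     continuous_map (prod_topology (rtop R) (mtop T)) (mtop T) (\<lambda>(r, x). r \<odot>\<^bsub>T\<^esub> x) \<and>
     continuous_map (prod_topology (gtop G) (mtop T)) (mtop T) (\<lambda>(g, x). mact T g x) \<and>
     (\<forall>x\<in>carrier T. mact T \<one>\<^bsub>G\<^esub> x = x) \<and>
     (\<forall>g\<in>carrier G. \<forall>h\<in>carrier G. \<forall>x\<in>carrier T.
        mact T (g \<otimes>\<^bsub>G\<^esub> h) x = mact T g (mact T h x)) \<and>
     (\<forall>g\<in>carrier G. \<forall>x\<in>carrier T. \<forall>y\<in>carrier T.
        mact T g (x \<oplus>\<^bsub>T\<^esub> y) = mact T g x \<oplus>\<^bsub>T\<^esub> mact T g y) \<and>
     (\<forall>g\<in>carrier G. \<forall>r\<in>carrier R. \<forall>x\<in>carrier T.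
        mact T g (r \<odot>\<^bsub>T\<^esub> x) = r \<odot>\<^bsub>T\<^esub> mact T g x)"

definition fin_gen_module :: "('r, 'd) ring_scheme \<Rightarrow> ('r, 't, 'e) module_scheme \<Rightarrow> bool" where
  "fin_gen_module R T \<longleftrightarrow> (\<exists>S. finite S \<and> S \<subseteq> carrier T \<and>
     (\<forall>x\<in>carrier T. \<exists>c\<in>S \<rightarrow> carrier R. x = (\<Oplus>\<^bsub>T\<^esub>s\<in>S. c s \<odot>\<^bsub>T\<^esub> s)))"

definition gmod_of :: "('g, 'r, 't, 'e) rgmod_scheme \<Rightarrow> ('g, 't) gmod" where
  "gmod_of T = \<lparr>carrier = carrier T, monoid.mult = (\<oplus>\<^bsub>T\<^esub>), one = \<zero>\<^bsub>T\<^esub>,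
                gtop = mtop T, act = mact T\<rparr>"

text \<open>The quotient by a subgroup stable under the action: \<open>g\<close> sends a coset to its
  elementwise image, which is again a coset.\<close>

definition quot_gmod :: "('g, 'm, 'c) gmod_scheme \<Rightarrow> 'm set \<Rightarrow> ('g, 'm set) gmod" where
  "quot_gmod M N =
     \<lparr>carrier = carrier (M Mod N), monoid.mult = (\<otimes>\<^bsub>M Mod N\<^esub>), one = \<one>\<^bsub>M Mod N\<^esub>,
      gtop = topology (\<lambda>V. V \<subseteq> carrier (M Mod N) \<and>
                           openin (gtop M) {x \<in> topspace (gtop M). N #>\<^bsub>M\<^esub> x \<in> V}),
      act = (\<lambda>g Y. act M g ` Y)\<rparr>"

section \<open>Continuous cohomology in degrees one and two\<close>

text \<open>Cochains are extensional functions, so that equality of cochains is equality on \<open>G\<close>.\<close>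

definition C1 :: "('g, 'c) tgroup_scheme \<Rightarrow> ('g, 'm, 'd) gmod_scheme \<Rightarrow> ('g \<Rightarrow> 'm) set" where
  "C1 G M = {f \<in> carrier G \<rightarrow>\<^sub>E carrier M. continuous_map (gtop G) (gtop M) f}"

definition C2 :: "('g, 'c) tgroup_scheme \<Rightarrow> ('g, 'm, 'd) gmod_scheme \<Rightarrow> ('g \<times> 'g \<Rightarrow> 'm) set" where
  "C2 G M = {f \<in> carrier G \<times> carrier G \<rightarrow>\<^sub>E carrier M.
               continuous_map (prod_topology (gtop G) (gtop G)) (gtop M) f}"

definition d0 :: "('g, 'c) tgroup_scheme \<Rightarrow> ('g, 'm, 'd) gmod_scheme \<Rightarrow> 'm \<Rightarrow> 'g \<Rightarrow> 'm" where
  "d0 G M x = (\<lambda>g\<in>carrier G. act M g x \<otimes>\<^bsub>M\<^esub> inv\<^bsub>M\<^esub> x)"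

definition d1 :: "('g, 'c) tgroup_scheme \<Rightarrow> ('g, 'm, 'd) gmod_scheme \<Rightarrow> ('g \<Rightarrow> 'm) \<Rightarrow> 'g \<times> 'g \<Rightarrow> 'm" where
  "d1 G M f = (\<lambda>(g, h)\<in>carrier G \<times> carrier G.
     act M g (f h) \<otimes>\<^bsub>M\<^esub> inv\<^bsub>M\<^esub> f (g \<otimes>\<^bsub>G\<^esub> h) \<otimes>\<^bsub>M\<^esub> f g)"

definition d2 :: "('g, 'c) tgroup_scheme \<Rightarrow> ('g, 'm, 'd) gmod_scheme \<Rightarrow> ('g \<times> 'g \<Rightarrow> 'm) \<Rightarrow>
    'g \<times> 'g \<times> 'g \<Rightarrow> 'm" where
  "d2 G M f = (\<lambda>(g, h, k)\<in>carrier G \<times> carrier G \<times> carrier G.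
     act M g (f (h, k)) \<otimes>\<^bsub>M\<^esub> inv\<^bsub>M\<^esub> f (g \<otimes>\<^bsub>G\<^esub> h, k) \<otimes>\<^bsub>M\<^esub> f (g, h \<otimes>\<^bsub>G\<^esub> k)
       \<otimes>\<^bsub>M\<^esub> inv\<^bsub>M\<^esub> f (g, h))"

definition Z1 :: "('g, 'c) tgroup_scheme \<Rightarrow> ('g, 'm, 'd) gmod_scheme \<Rightarrow> ('g \<Rightarrow> 'm) monoid" where
  "Z1 G M = (product_group (carrier G) (\<lambda>_. M))
     \<lparr>carrier := {f \<in> C1 G M. \<forall>p\<in>carrier G \<times> carrier G. d1 G M f p = \<one>\<^bsub>M\<^esub>}\<rparr>"

definition Z2 :: "('g, 'c) tgroup_scheme \<Rightarrow> ('g, 'm, 'd) gmod_scheme \<Rightarrow> ('g \<times> 'g \<Rightarrow> 'm) monoid" where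
  "Z2 G M = (product_group (carrier G \<times> carrier G) (\<lambda>_. M))
     \<lparr>carrier := {f \<in> C2 G M. \<forall>p\<in>carrier G \<times> carrier G \<times> carrier G. d2 G M f p = \<one>\<^bsub>M\<^esub>}\<rparr>"

definition B1 :: "('g, 'c) tgroup_scheme \<Rightarrow> ('g, 'm, 'd) gmod_scheme \<Rightarrow> ('g \<Rightarrow> 'm) set" where
  "B1 G M = d0 G M ` carrier M"

definition B2 :: "('g, 'c) tgroup_scheme \<Rightarrow> ('g, 'm, 'd) gmod_scheme \<Rightarrow> ('g \<times> 'g \<Rightarrow> 'm) set" where
  "B2 G M = d1 G M ` C1 G M"

definition H1 :: "('g, 'c) tgroup_scheme \<Rightarrow> ('g, 'm, 'd) gmod_scheme \<Rightarrow> ('g \<Rightarrow> 'm) set monoid" where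
  "H1 G M = Z1 G M Mod B1 G M"

definition H2 :: "('g, 'c) tgroup_scheme \<Rightarrow> ('g, 'm, 'd) gmod_scheme \<Rightarrow> ('g \<times> 'g \<Rightarrow> 'm) set monoid" where
  "H2 G M = Z2 G M Mod B2 G M"

definition class1 :: "('g, 'c) tgroup_scheme \<Rightarrow> ('g, 'm, 'd) gmod_scheme \<Rightarrow> ('g \<Rightarrow> 'm) \<Rightarrow> ('g \<Rightarrow> 'm) set" where
  "class1 G M f = B1 G M #>\<^bsub>Z1 G M\<^esub> f"

definition class2 :: "('g, 'c) tgroup_scheme \<Rightarrow> ('g, 'm, 'd) gmod_scheme \<Rightarrow> ('g \<times> 'g \<Rightarrow> 'm) \<Rightarrow>
    ('g \<times> 'g \<Rightarrow> 'm) set" where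
  "class2 G M f = B2 G M #>\<^bsub>Z2 G M\<^esub> f"

text \<open>The connecting map \<open>H\<^sup>1(G,C) \<rightarrow> H\<^sup>2(G,A)\<close> of \<open>0 \<rightarrow> A \<rightarrow> B \<rightarrow> C \<rightarrow> 0\<close> (maps \<open>i\<close>, \<open>p\<close>): lift a
  representing cocycle to a continuous cochain \<open>b\<close> with values in \<open>B\<close>, and take the class of
  the cocycle \<open>z\<close> with \<open>i \<circ> z = d1 b\<close>.\<close>

definition connecting ::
  "('g, 'c) tgroup_scheme \<Rightarrow> ('g, 'm1, 'd1) gmod_scheme \<Rightarrow> ('g, 'm2, 'd2) gmod_scheme \<Rightarrow>
   ('g, 'm3, 'd3) gmod_scheme \<Rightarrow> ('m1 \<Rightarrow> 'm2) \<Rightarrow> ('m2 \<Rightarrow> 'm3) \<Rightarrow>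
   ('g \<Rightarrow> 'm3) set \<Rightarrow> ('g \<times> 'g \<Rightarrow> 'm1) set" where
  "connecting G A B C i p x = (THE y. y \<in> carrier (H2 G A) \<and>
     (\<exists>c\<in>x. \<exists>b\<in>C1 G B. \<exists>z\<in>carrier (Z2 G A).
        (\<forall>g\<in>carrier G. p (b g) = c g) \<and>
        (\<forall>q\<in>carrier G \<times> carrier G. i (z q) = d1 G B b q) \<and>
        y = class2 G A z))"

section \<open>Matrices\<close>

text \<open>An \<open>m \<times> n\<close> matrix is an extensional function on \<open>{1..m} \<times> {1..n}\<close>.\<close>

definition mat_idx :: "nat \<Rightarrow> nat \<Rightarrow> (nat \<times> nat) set" where
  "mat_idx m n = {1..m} \<times> {1..n}"

definition rmat_mult :: "('r, 'd) ring_scheme \<Rightarrow> nat \<Rightarrow> (nat \<times> nat \<Rightarrow> 'r) \<Rightarrow> (nat \<times> nat \<Rightarrow> 'r) \<Rightarrow>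
    nat \<times> nat \<Rightarrow> 'r" where
  "rmat_mult R k A B = (\<lambda>(i, j)\<in>mat_idx k k. \<Oplus>\<^bsub>R\<^esub>l\<in>{1..k}. A (i, l) \<otimes>\<^bsub>R\<^esub> B (l, j))"

definition rmat_one :: "('r, 'd) ring_scheme \<Rightarrow> nat \<Rightarrow> nat \<times> nat \<Rightarrow> 'r" where
  "rmat_one R k = (\<lambda>(i, j)\<in>mat_idx k k. if i = j then \<one>\<^bsub>R\<^esub> else \<zero>\<^bsub>R\<^esub>)"

text \<open>Products of matrices over \<open>R\<close> with \<open>m \<times> n\<close> matrices over \<open>T\<close>, from the left and
  from the right; \<open>R\<close> is commutative, so \<open>x r = r x\<close> for \<open>x\<close> in \<open>T\<close>.\<close>

definition mat_lmult :: "('r, 't, 'e) module_scheme \<Rightarrow> nat \<Rightarrow> nat \<Rightarrow> (nat \<times> nat \<Rightarrow> 'r) \<Rightarrow>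
    (nat \<times> nat \<Rightarrow> 't) \<Rightarrow> nat \<times> nat \<Rightarrow> 't" where
  "mat_lmult T m n P X = (\<lambda>(i, j)\<in>mat_idx m n. \<Oplus>\<^bsub>T\<^esub>l\<in>{1..m}. P (i, l) \<odot>\<^bsub>T\<^esub> X (l, j))"

definition mat_rmult :: "('r, 't, 'e) module_scheme \<Rightarrow> nat \<Rightarrow> nat \<Rightarrow> (nat \<times> nat \<Rightarrow> 't) \<Rightarrow>
    (nat \<times> nat \<Rightarrow> 'r) \<Rightarrow> nat \<times> nat \<Rightarrow> 't" where
  "mat_rmult T m n X Q = (\<lambda>(i, j)\<in>mat_idx m n. \<Oplus>\<^bsub>T\<^esub>l\<in>{1..n}. Q (l, j) \<odot>\<^bsub>T\<^esub> X (i, l))"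

definition mat_add :: "('t, 'e) ring_scheme \<Rightarrow> nat \<Rightarrow> nat \<Rightarrow> (nat \<times> nat \<Rightarrow> 't) \<Rightarrow>
    (nat \<times> nat \<Rightarrow> 't) \<Rightarrow> nat \<times> nat \<Rightarrow> 't" where
  "mat_add T m n X Y = (\<lambda>q\<in>mat_idx m n. X q \<oplus>\<^bsub>T\<^esub> Y q)"

definition mat_zero :: "('t, 'e) ring_scheme \<Rightarrow> nat \<Rightarrow> nat \<Rightarrow> nat \<times> nat \<Rightarrow> 't" where
  "mat_zero T m n = (\<lambda>q\<in>mat_idx m n. \<zero>\<^bsub>T\<^esub>)"

definition mat_act :: "('g, 'r, 't, 'e) rgmod_scheme \<Rightarrow> nat \<Rightarrow> nat \<Rightarrow> 'g \<Rightarrow> (nat \<times> nat \<Rightarrow> 't) \<Rightarrow>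
    nat \<times> nat \<Rightarrow> 't" where
  "mat_act T m n g X = (\<lambda>q\<in>mat_idx m n. mact T g (X q))"

definition mat_corner :: "('t, 'e) ring_scheme \<Rightarrow> nat \<Rightarrow> nat \<Rightarrow> 't \<Rightarrow> nat \<times> nat \<Rightarrow> 't" where
  "mat_corner T m n t = (\<lambda>q\<in>mat_idx m n. if q = (1, n) then t else \<zero>\<^bsub>T\<^esub>)"

definition unitri :: "('r, 'd) tring_scheme \<Rightarrow> nat \<Rightarrow> (nat \<times> nat \<Rightarrow> 'r) tgroup" where
  "unitri R k = (let U = {A \<in> mat_idx k k \<rightarrow>\<^sub>E carrier R.
                           (\<forall>i\<in>{1..k}. A (i, i) = \<one>\<^bsub>R\<^esub>) \<and>
                           (\<forall>i\<in>{1..k}. \<forall>j\<in>{1..k}. j < i \<longrightarrow> A (i, j) = \<zero>\<^bsub>R\<^esub>)} in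
     \<lparr>carrier = U, monoid.mult = rmat_mult R k, one = rmat_one R k,
      gtop = subtopology (product_topology (\<lambda>_. rtop R) (mat_idx k k)) U\<rparr>)"

definition partial_defining_system ::
  "('g, 'c) tgroup_scheme \<Rightarrow> ('r, 'd) tring_scheme \<Rightarrow> nat \<Rightarrow> nat \<Rightarrow>
   ('g \<Rightarrow> nat \<times> nat \<Rightarrow> 'r) \<Rightarrow> ('g \<Rightarrow> nat \<times> nat \<Rightarrow> 'r) \<Rightarrow> bool" where
  "partial_defining_system G R a b \<phi> \<theta> \<longleftrightarrow>
     \<phi> \<in> hom G (unitri R (a + 1)) \<and> continuous_map (gtop G) (gtop (unitri R (a + 1))) \<phi> \<and>
     \<theta> \<in> hom G (unitri R (b + 1)) \<and> continuous_map (gtop G) (gtop (unitri R (b + 1))) \<theta>"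

section \<open>The modules of matrices with twisted action\<close>

definition frakU ::
  "('r, 'd) tring_scheme \<Rightarrow> ('g, 'r, 't, 'e) rgmod_scheme \<Rightarrow> nat \<Rightarrow> nat \<Rightarrow>
   ('g \<Rightarrow> nat \<times> nat \<Rightarrow> 'r) \<Rightarrow> ('g \<Rightarrow> nat \<times> nat \<Rightarrow> 'r) \<Rightarrow> ('g, nat \<times> nat \<Rightarrow> 't) gmod" where
  "frakU R T a b \<phi> \<theta> =
     \<lparr>carrier = mat_idx (a + 1) (b + 1) \<rightarrow>\<^sub>E carrier T,
      monoid.mult = mat_add T (a + 1) (b + 1),
      one = mat_zero T (a + 1) (b + 1),
      gtop = product_topology (\<lambda>_. mtop T) (mat_idx (a + 1) (b + 1)),
      act = (\<lambda>g X. mat_rmult T (a + 1) (b + 1)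
                     (mat_lmult T (a + 1) (b + 1) (\<phi> g) (mat_act T (a + 1) (b + 1) g X))
                     (inv\<^bsub>unitri R (b + 1)\<^esub> (\<theta> g)))\<rparr>"

definition frakU_incl :: "('t, 'e) ring_scheme \<Rightarrow> nat \<Rightarrow> nat \<Rightarrow> 't \<Rightarrow> nat \<times> nat \<Rightarrow> 't" where
  "frakU_incl T a b = mat_corner T (a + 1) (b + 1)"

definition frakU' ::
  "('r, 'd) tring_scheme \<Rightarrow> ('g, 'r, 't, 'e) rgmod_scheme \<Rightarrow> nat \<Rightarrow> nat \<Rightarrow>
   ('g \<Rightarrow> nat \<times> nat \<Rightarrow> 'r) \<Rightarrow> ('g \<Rightarrow> nat \<times> nat \<Rightarrow> 'r) \<Rightarrow> ('g, (nat \<times> nat \<Rightarrow> 't) set) gmod" where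
  "frakU' R T a b \<phi> \<theta> = quot_gmod (frakU R T a b \<phi> \<theta>) (frakU_incl T a b ` carrier T)"

definition frakU_proj ::
  "('r, 'd) tring_scheme \<Rightarrow> ('g, 'r, 't, 'e) rgmod_scheme \<Rightarrow> nat \<Rightarrow> nat \<Rightarrow>
   ('g \<Rightarrow> nat \<times> nat \<Rightarrow> 'r) \<Rightarrow> ('g \<Rightarrow> nat \<times> nat \<Rightarrow> 'r) \<Rightarrow> (nat \<times> nat \<Rightarrow> 't) \<Rightarrow> (nat \<times> nat \<Rightarrow> 't) set" where
  "frakU_proj R T a b \<phi> \<theta> X = (frakU_incl T a b ` carrier T) #>\<^bsub>frakU R T a b \<phi> \<theta>\<^esub> X"

text \<open>The common value of an entry (other than the upper right one) on a class modulo \<open>T\<close>.\<close>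

definition quot_entry :: "(nat \<times> nat \<Rightarrow> 't) set \<Rightarrow> nat \<Rightarrow> nat \<Rightarrow> 't" where
  "quot_entry Y i j = the_elem ((\<lambda>X. X (i, j)) ` Y)"

section \<open>Block matrices, proper defining systems and Massey products\<close>

text \<open>The triple \<open>(P, X, Q)\<close> stands for the matrix of size \<open>a + b + 2\<close> with diagonal blocks
  \<open>P\<close>, \<open>Q\<close>, upper right block \<open>X\<close> and lower left block zero.\<close>

type_synonym ('r, 't) block = "(nat \<times> nat \<Rightarrow> 'r) \<times> (nat \<times> nat \<Rightarrow> 't) \<times> (nat \<times> nat \<Rightarrow> 'r)"

definition calU ::
  "('r, 'd) tring_scheme \<Rightarrow> ('g, 'r, 't, 'e) rgmod_scheme \<Rightarrow> nat \<Rightarrow> nat \<Rightarrow>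
   ('g, ('r, 't) block) gmod" where
  "calU R T a b =
     \<lparr>carrier = carrier (unitri R (a + 1)) \<times> (mat_idx (a + 1) (b + 1) \<rightarrow>\<^sub>E carrier T) \<times>
                carrier (unitri R (b + 1)),
      monoid.mult = (\<lambda>(P, X, Q) (P', X', Q').
        (rmat_mult R (a + 1) P P',
         mat_add T (a + 1) (b + 1) (mat_lmult T (a + 1) (b + 1) P X')
                                   (mat_rmult T (a + 1) (b + 1) X Q'),
         rmat_mult R (b + 1) Q Q')),
      one = (rmat_one R (a + 1), mat_zero T (a + 1) (b + 1), rmat_one R (b + 1)),
      gtop = prod_topology (gtop (unitri R (a + 1)))
               (prod_topology (product_topology (\<lambda>_. mtop T) (mat_idx (a + 1) (b + 1)))
                              (gtop (unitri R (b + 1)))),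
      act = (\<lambda>g (P, X, Q). (P, mat_act T (a + 1) (b + 1) g X, Q))\<rparr>"

definition calU_centre ::
  "('r, 'd) tring_scheme \<Rightarrow> ('g, 'r, 't, 'e) rgmod_scheme \<Rightarrow> nat \<Rightarrow> nat \<Rightarrow> ('r, 't) block set" where
  "calU_centre R T a b =
     {rmat_one R (a + 1)} \<times> (mat_corner T (a + 1) (b + 1) ` carrier T) \<times> {rmat_one R (b + 1)}"

definition calU' ::
  "('r, 'd) tring_scheme \<Rightarrow> ('g, 'r, 't, 'e) rgmod_scheme \<Rightarrow> nat \<Rightarrow> nat \<Rightarrow>
   ('g, ('r, 't) block set) gmod" where
  "calU' R T a b = quot_gmod (calU R T a b) (calU_centre R T a b)"

text \<open>The element of \<open>calU'\<close> with diagonal blocks \<open>P\<close>, \<open>Q\<close> and upper right block the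
  class \<open>Y\<close> of matrices modulo \<open>T\<close>; as a coset it consists of all \<open>(P, X, Q)\<close> with \<open>X \<in> Y\<close>.\<close>

definition block' ::
  "(nat \<times> nat \<Rightarrow> 'r) \<Rightarrow> (nat \<times> nat \<Rightarrow> 't) set \<Rightarrow> (nat \<times> nat \<Rightarrow> 'r) \<Rightarrow> ('r, 't) block set" where
  "block' P Y Q = {P} \<times> Y \<times> {Q}"

text \<open>As a group, \<open>frakU'\<close> is the group of matrices modulo \<open>T\<close> for every \<open>\<phi>\<close>, \<open>\<theta>\<close>.\<close>

definition proper_defining_system ::
  "('g, 'c) tgroup_scheme \<Rightarrow> ('r, 'd) tring_scheme \<Rightarrow> ('g, 'r, 't, 'e) rgmod_scheme \<Rightarrow> nat \<Rightarrow> nat \<Rightarrow>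
   ('g \<Rightarrow> nat \<times> nat \<Rightarrow> 'r) \<Rightarrow> ('g \<Rightarrow> nat \<times> nat \<Rightarrow> 'r) \<Rightarrow> ('g \<Rightarrow> ('r, 't) block set) \<Rightarrow> bool" where
  "proper_defining_system G R T a b \<phi> \<theta> \<rho> \<longleftrightarrow>
     \<rho> \<in> carrier G \<rightarrow> carrier (calU' R T a b) \<and>
     continuous_map (gtop G) (gtop (calU' R T a b)) \<rho> \<and>
     (\<forall>g\<in>carrier G. \<forall>h\<in>carrier G.
        \<rho> (g \<otimes>\<^bsub>G\<^esub> h) = \<rho> g \<otimes>\<^bsub>calU' R T a b\<^esub> act (calU' R T a b) g (\<rho> h)) \<and>
     (\<exists>\<kappa>\<in>carrier G \<rightarrow> carrier (frakU' R T a b \<phi> \<theta>).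
        \<forall>g\<in>carrier G. \<rho> g = block' (\<phi> g) (\<kappa> g) (\<theta> g))"

definition calU_lift :: "('t, 'e) ring_scheme \<Rightarrow> nat \<Rightarrow> ('r, 't) block set \<Rightarrow> ('r, 't) block" where
  "calU_lift T b C = (THE A. A \<in> C \<and> fst (snd A) (1, b + 1) = \<zero>\<^bsub>T\<^esub>)"

text \<open>With \<open>n = a + b\<close>, the sum over \<open>i = 2, \<dots>, n + 1\<close> of the products of the \<open>(1, i)\<close>- and
  \<open>(i, n + 2)\<close>-entries of the lifts splits according to the block of the entries: for
  \<open>i \<le> a + 1\<close> they are \<open>P (1, i)\<close> and \<open>X (i, b + 1)\<close>, and for \<open>i = a + 1 + l\<close> they are \<open>X (1, l)\<close>
  and \<open>Q (l, b + 1)\<close>, where \<open>G\<close> fixes the entries of \<open>Q\<close>.\<close>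

definition massey_cocycle ::
  "('g, 'c) tgroup_scheme \<Rightarrow> ('g, 'r, 't, 'e) rgmod_scheme \<Rightarrow> nat \<Rightarrow> nat \<Rightarrow>
   ('g \<Rightarrow> ('r, 't) block set) \<Rightarrow> 'g \<times> 'g \<Rightarrow> 't" where
  "massey_cocycle G T a b \<rho> = (\<lambda>(g, h)\<in>carrier G \<times> carrier G.
     case calU_lift T b (\<rho> g) of (P, X, Q) \<Rightarrow> case calU_lift T b (\<rho> h) of (P', X', Q') \<Rightarrow>
       (\<Oplus>\<^bsub>T\<^esub>i\<in>{2..a + 1}. P (1, i) \<odot>\<^bsub>T\<^esub> mact T g (X' (i, b + 1))) \<oplus>\<^bsub>T\<^esub>
       (\<Oplus>\<^bsub>T\<^esub>l\<in>{1..b}. Q' (l, b + 1) \<odot>\<^bsub>T\<^esub> X (1, l)))"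

definition massey_product ::
  "('g, 'c) tgroup_scheme \<Rightarrow> ('g, 'r, 't, 'e) rgmod_scheme \<Rightarrow> nat \<Rightarrow> nat \<Rightarrow>
   ('g \<Rightarrow> ('r, 't) block set) \<Rightarrow> ('g \<times> 'g \<Rightarrow> 't) set" where
  "massey_product G T a b \<rho> = class2 G (gmod_of T) (massey_cocycle G T a b \<rho>)"

text \<open>The Massey product \<open>(\<alpha>\<^sub>1, \<dots>, \<alpha>\<^sub>a, \<lambda>, \<beta>\<^sub>1, \<dots>, \<beta>\<^sub>b)\<^sub>\<rho>\<close> depends on \<open>\<rho>\<close> only; the maps listed are
  the entries of \<open>\<rho>\<close> just above the diagonal, which is what the following predicate says.\<close>

definition massey_arguments ::
  "('g, 'c) tgroup_scheme \<Rightarrow> ('t, 'e) ring_scheme \<Rightarrow> nat \<Rightarrow> nat \<Rightarrow> ('g \<Rightarrow> ('r, 't) block set) \<Rightarrow>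
   (nat \<Rightarrow> 'g \<Rightarrow> 'r) \<Rightarrow> ('g \<Rightarrow> 't) \<Rightarrow> (nat \<Rightarrow> 'g \<Rightarrow> 'r) \<Rightarrow> bool" where
  "massey_arguments G T a b \<rho> \<alpha> lam \<beta> \<longleftrightarrow>
     (\<forall>g\<in>carrier G. case calU_lift T b (\<rho> g) of (P, X, Q) \<Rightarrow>
        (\<forall>i\<in>{1..a}. P (i, i + 1) = \<alpha> i g) \<and>
        X (a + 1, 1) = lam g \<and>
        (\<forall>i\<in>{1..b}. Q (i, i + 1) = \<beta> i g))"

end

theory Submission
  imports Defs
begin

text \<open>
  Choose the continuous lift \<open>\<kappa>\<close> of \<open>\<kappa>'\<close> to matrices over \<open>T\<close> for which \<open>X = \<kappa> \<theta>\<close> has upper right entry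
  zero. Multiplying the coboundary \<open>g \<star> \<kappa>(h) - \<kappa>(gh) + \<kappa>(g)\<close> on the right by \<open>\<theta>(gh)\<close> gives
  \<open>\<phi>(g) gX(h) + X(g) \<theta>(h) - X(gh)\<close>. Since \<open>\<kappa>'\<close> is a cocycle, the coboundary is concentrated in
  the upper right entry, where multiplication by a unitriangular matrix does nothing; as \<open>X(gh)\<close>
  vanishes there, the entry is that of \<open>\<phi>(g) gX(h) + X(g) \<theta>(h)\<close>, which is the Massey cocycle.
  The connecting map may be computed with any continuous lift because taking the upper right entry
  is a continuous retraction of the matrices onto \<open>T\<close>.
\<close>

section \<open>Connecting map\<close>

text \<open>\<open>connecting\<close> is a definite description over all representatives, all
  continuous lifts and all cocycles, so exhibiting one good lift does not evaluate it: uniqueness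
  has to be proved against every other choice. This is done for an abstract short exact sequence.
  Two normalisations compete. The Massey cocycle is built from the lift of \<open>\<rho>\<close>
  with zero corner, whose upper right block is \<open>\<kappa> \<theta>\<close>, while the obvious
  continuous lift of \<open>\<kappa>'\<close> puts zero in the corner of the lift itself. The two
  lifts differ by a corner matrix; since unitriangular multiplication fixes corner matrices, the
  correction is explicit and continuous. The computation of the coboundary serves twice. Its corner
  entry is the Massey cocycle; the whole identity, read modulo corner matrices, says that
  \<open>\<rho>\<close> is multiplicative, which is what makes it a proper defining system.\<close>

lemma (in group) l_inv_cancel:
  "\<lbrakk>x \<in> carrier G; y \<in> carrier G\<rbrakk> \<Longrightarrow> inv x \<otimes> (x \<otimes> y) = y"
  by (simp flip: m_assoc)

text \<open>This is the vanishing of \<open>d2 (d1 f)\<close> at \<open>(g, h, k)\<close>: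
  \<open>x\<close>, \<open>y\<close>, \<open>z\<close> stand for gh f(k), g f(hk), g f(h), and
  \<open>u\<close>, \<open>v\<close>, \<open>w\<close> for f(ghk), f(gh), f(g). Each of the six
  occurs once as a factor and once inverted.\<close>

lemma (in comm_group) cocycle_identity_2:
  assumes "x \<in> carrier G" "y \<in> carrier G" "z \<in> carrier G" "u \<in> carrier G" "v \<in> carrier G" "w \<in> carrier G"
  shows "(x \<otimes> inv y \<otimes> z) \<otimes> inv (x \<otimes> inv u \<otimes> v) \<otimes> (y \<otimes> inv u \<otimes> w) \<otimes> inv (z \<otimes> inv v \<otimes> w) = \<one>"
proof -
  \<comment> \<open>Formal fractions: the rules for \<open>dv\<close> merge the product into a
    single fraction, whose numerator and denominator then agree up to order.\<close>
  define dv where "dv a b = a \<otimes> inv b" for a b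
  have dv: "a \<otimes> inv b = dv a b" "dv a b \<in> carrier G" "dv a b \<otimes> c = dv (a \<otimes> c) b"
    "c \<otimes> dv a b = dv (c \<otimes> a) b" "dv (dv a b) c = dv a (b \<otimes> c)" "dv c (dv a b) = dv (c \<otimes> b) a"
    if "a \<in> carrier G" "b \<in> carrier G" "c \<in> carrier G" for a b c
    using that by (auto simp: dv_def inv_mult m_ac)
  have "dv a a = \<one>" if "a \<in> carrier G" for a
    using that by (simp add: dv_def)
  with assms show ?thesis
    by (simp add: dv m_ac)
qed

text \<open>The vanishing of \<open>d1 (d0 t)\<close> at \<open>(g, h)\<close>, with
  \<open>x\<close>, \<open>y\<close>, \<open>z\<close> standing for ght, gt and t.\<close>

lemma (in comm_group) cocycle_identity_1:
  assumes "x \<in> carrier G" "y \<in> carrier G" "z \<in> carrier G"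
  shows "x \<otimes> inv y \<otimes> inv (x \<otimes> inv z) \<otimes> (y \<otimes> inv z) = \<one>"
  using cocycle_identity_2[of x y \<one> z \<one> \<one>] assms by simp

section \<open>Continuous cochains with values in a topological module\<close>

text \<open>The locale is instantiated with \<open>gmod_of T\<close> and with \<open>frakU\<close>.
  The quotient \<open>frakU'\<close> enters the connecting map only as an abelian group with an
  action that the projection respects.\<close>

locale top_gmodule = G: group G + M: comm_group M
  for G :: "('g, 'c) tgroup_scheme" (structure) and M :: "('g, 'm, 'd) gmod_scheme" +
  assumes topspace_G: "topspace (gtop G) = carrier G"
    and continuous_G: "continuous_map (prod_topology (gtop G) (gtop G)) (gtop G) (\<lambda>(x, y). x \<otimes>\<^bsub>G\<^esub> y)"
    and topspace_M: "topspace (gtop M) = carrier M"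
    and continuous_M: "continuous_map (prod_topology (gtop M) (gtop M)) (gtop M) (\<lambda>(x, y). x \<otimes>\<^bsub>M\<^esub> y)"
    and continuous_inv: "continuous_map (gtop M) (gtop M) (\<lambda>x. inv\<^bsub>M\<^esub> x)"
    and continuous_act: "continuous_map (prod_topology (gtop G) (gtop M)) (gtop M) (\<lambda>(g, x). act M g x)"
    and act_one: "x \<in> carrier M \<Longrightarrow> act M \<one>\<^bsub>G\<^esub> x = x"
    and act_act: "\<lbrakk>g \<in> carrier G; h \<in> carrier G; x \<in> carrier M\<rbrakk> \<Longrightarrow>
      act M (g \<otimes>\<^bsub>G\<^esub> h) x = act M g (act M h x)"
    and act_mult: "\<lbrakk>g \<in> carrier G; x \<in> carrier M; y \<in> carrier M\<rbrakk> \<Longrightarrow>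
      act M g (x \<otimes>\<^bsub>M\<^esub> y) = act M g x \<otimes>\<^bsub>M\<^esub> act M g y"
begin

text \<open>Closure comes from continuity: a continuous map sends \<open>topspace\<close> into
  \<open>topspace\<close>, and these are the carriers.\<close>

lemma act_closed [simp]: "\<lbrakk>g \<in> carrier G; x \<in> carrier M\<rbrakk> \<Longrightarrow> act M g x \<in> carrier M"
  using continuous_map_image_subset_topspace[OF continuous_act] by (auto simp: topspace_G topspace_M)

lemma act_inv:
  assumes "g \<in> carrier G" "x \<in> carrier M"
  shows "act M g (inv\<^bsub>M\<^esub> x) = inv\<^bsub>M\<^esub> act M g x"
proof -
  have "group_hom M M (act M g)"
    using assms by unfold_locales (auto simp: hom_def act_mult)
  then show ?thesis
    using assms group_hom.hom_inv by metis
qed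

lemma continuous_mult:
  assumes "continuous_map X (gtop M) f" "continuous_map X (gtop M) f'"
  shows "continuous_map X (gtop M) (\<lambda>x. f x \<otimes>\<^bsub>M\<^esub> f' x)"
  using continuous_map_compose[OF continuous_map_pairedI[OF assms] continuous_M]
  by (simp add: o_def)

lemma continuous_inverse:
  assumes "continuous_map X (gtop M) f"
  shows "continuous_map X (gtop M) (\<lambda>x. inv\<^bsub>M\<^esub> f x)"
  using continuous_map_compose[OF assms continuous_inv] by (simp add: o_def)

lemma continuous_action:
  assumes "continuous_map X (gtop G) u" "continuous_map X (gtop M) f"
  shows "continuous_map X (gtop M) (\<lambda>x. act M (u x) (f x))"
  using continuous_map_compose[OF continuous_map_pairedI[OF assms] continuous_act]
  by (simp add: o_def)

lemma C1_closed: "\<lbrakk>f \<in> C1 G M; g \<in> carrier G\<rbrakk> \<Longrightarrow> f g \<in> carrier M"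
  by (auto simp: C1_def)

lemma C1_continuous: "f \<in> C1 G M \<Longrightarrow> continuous_map (gtop G) (gtop M) f"
  by (auto simp: C1_def)

lemma C1_restrictI:
  assumes "continuous_map (gtop G) (gtop M) f"
  shows "(\<lambda>g\<in>carrier G. f g) \<in> C1 G M"
proof -
  have "continuous_map (gtop G) (gtop M) (\<lambda>g\<in>carrier G. f g)"
    by (rule continuous_map_eq[OF assms]) (simp add: topspace_G)
  moreover have "f g \<in> carrier M" if "g \<in> carrier G" for g
    using continuous_map_image_subset_topspace[OF assms] that by (auto simp: topspace_G topspace_M)
  ultimately show ?thesis
    by (simp add: C1_def)
qed

lemma C1_mult: "\<lbrakk>f \<in> C1 G M; f' \<in> C1 G M\<rbrakk> \<Longrightarrow> (\<lambda>g\<in>carrier G. f g \<otimes>\<^bsub>M\<^esub> f' g) \<in> C1 G M"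
  by (intro C1_restrictI continuous_mult C1_continuous)

lemma C1_inv: "f \<in> C1 G M \<Longrightarrow> (\<lambda>g\<in>carrier G. inv\<^bsub>M\<^esub> f g) \<in> C1 G M"
  by (intro C1_restrictI continuous_inverse C1_continuous)

lemma d0_C1: "x \<in> carrier M \<Longrightarrow> d0 G M x \<in> C1 G M"
  unfolding d0_def
  by (intro C1_restrictI continuous_mult continuous_inverse continuous_action)
    (auto simp: topspace_M)

lemma d1_apply: "\<lbrakk>g \<in> carrier G; h \<in> carrier G\<rbrakk> \<Longrightarrow>
    d1 G M f (g, h) = act M g (f h) \<otimes>\<^bsub>M\<^esub> inv\<^bsub>M\<^esub> f (g \<otimes> h) \<otimes>\<^bsub>M\<^esub> f g"
  by (simp add: d1_def)

lemma d1_closed: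
  assumes "f \<in> carrier G \<rightarrow> carrier M" "p \<in> carrier G \<times> carrier G"
  shows "d1 G M f p \<in> carrier M"
  using assms by (auto simp: d1_apply Pi_iff)

lemma d1_mult:
  assumes "f \<in> carrier G \<rightarrow> carrier M" "f' \<in> carrier G \<rightarrow> carrier M" "p \<in> carrier G \<times> carrier G"
  shows "d1 G M (\<lambda>g\<in>carrier G. f g \<otimes>\<^bsub>M\<^esub> f' g) p = d1 G M f p \<otimes>\<^bsub>M\<^esub> d1 G M f' p"
  using assms by (auto simp: d1_apply Pi_iff act_mult M.inv_mult M.m_ac)

lemma d1_inv:
  assumes "f \<in> carrier G \<rightarrow> carrier M" "p \<in> carrier G \<times> carrier G"
  shows "d1 G M (\<lambda>g\<in>carrier G. inv\<^bsub>M\<^esub> f g) p = inv\<^bsub>M\<^esub> d1 G M f p"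
  using assms by (auto simp: d1_apply Pi_iff act_inv M.inv_mult M.m_ac)

lemma d1_d0:
  assumes "x \<in> carrier M" "p \<in> carrier G \<times> carrier G"
  shows "d1 G M (d0 G M x) p = \<one>\<^bsub>M\<^esub>"
proof (cases p)
  case (Pair g h)
  with assms have gh: "g \<in> carrier G" "h \<in> carrier G" by auto
  show ?thesis
    unfolding Pair using assms(1) gh
    by (simp add: d1_apply d0_def act_mult act_inv act_act M.cocycle_identity_1)
qed

lemma d2_d1:
  assumes "f \<in> carrier G \<rightarrow> carrier M" "p \<in> carrier G \<times> carrier G \<times> carrier G"
  shows "d2 G M (d1 G M f) p = \<one>\<^bsub>M\<^esub>"
proof (cases p)
  case (fields g h k)
  with assms have ghk: "g \<in> carrier G" "h \<in> carrier G" "k \<in> carrier G" by auto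
  have f: "\<And>x. x \<in> carrier G \<Longrightarrow> f x \<in> carrier M"
    using assms by auto
  show ?thesis
    unfolding fields using ghk f
    by (simp add: d2_def d1_apply act_mult act_inv act_act G.m_assoc M.cocycle_identity_2)
qed

lemma d1_C2:
  assumes "f \<in> C1 G M"
  shows "d1 G M f \<in> C2 G M"
proof -
  let ?X = "prod_topology (gtop G) (gtop G)"
  have m: "continuous_map ?X (gtop G) (\<lambda>p. fst p \<otimes> snd p)"
    using continuous_G by (simp add: case_prod_unfold)
  have f: "continuous_map ?X (gtop M) (\<lambda>p. f (u p))" if "continuous_map ?X (gtop G) u" for u
    using continuous_map_compose[OF that C1_continuous[OF assms]] by (simp add: o_def)
  have "continuous_map ?X (gtop M)
      (\<lambda>p. act M (fst p) (f (snd p)) \<otimes>\<^bsub>M\<^esub> inv\<^bsub>M\<^esub> f (fst p \<otimes> snd p) \<otimes>\<^bsub>M\<^esub> f (fst p))"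
    by (intro continuous_mult continuous_inverse continuous_action f m continuous_map_fst
        continuous_map_snd)
  then have "continuous_map ?X (gtop M) (d1 G M f)"
    by (rule continuous_map_eq) (auto simp: d1_apply topspace_G)
  moreover have "d1 G M f \<in> carrier G \<times> carrier G \<rightarrow>\<^sub>E carrier M"
    using d1_closed[of f] C1_closed[OF assms] by (auto simp: d1_def)
  ultimately show ?thesis
    by (simp add: C2_def)
qed

text \<open>The classes are compared as sets of functions, namely all translates by coboundaries.
  The inclusions come from the substitutions v to vw and v to v/w on cochains, so the argument stays
  pointwise instead of passing through the group structure on cocycles.\<close>

lemma class2_eqI:
  assumes "w \<in> C1 G M" "z \<in> carrier G \<times> carrier G \<rightarrow>\<^sub>E carrier M" "z' \<in> extensional (carrier G \<times> carrier G)"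
    and eq: "\<And>p. p \<in> carrier G \<times> carrier G \<Longrightarrow> z' p = d1 G M w p \<otimes>\<^bsub>M\<^esub> z p"
  shows "class2 G M z' = class2 G M z"
proof -
  let ?I = "carrier G \<times> carrier G"
  have c: "class2 G M y = (\<lambda>v. \<lambda>p\<in>?I. d1 G M v p \<otimes>\<^bsub>M\<^esub> y p) ` C1 G M" for y
    by (auto simp: class2_def r_coset_def B2_def Z2_def image_iff)
  have z: "z p \<in> carrier M" if "p \<in> ?I" for p
    using assms(2) that by auto
  have d: "d1 G M v p \<in> carrier M" if "v \<in> C1 G M" "p \<in> ?I" for v p
    using d1_closed C1_closed that by blast
  have fn: "v \<in> carrier G \<rightarrow> carrier M" if "v \<in> C1 G M" for v
    using C1_closed that by blast
  show ?thesis
  proof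
    show "class2 G M z' \<subseteq> class2 G M z"
    proof
      fix y assume "y \<in> class2 G M z'"
      then obtain v where v: "v \<in> C1 G M" and y: "y = (\<lambda>p\<in>?I. d1 G M v p \<otimes>\<^bsub>M\<^esub> z' p)"
        unfolding c by blast
      let ?v = "\<lambda>g\<in>carrier G. v g \<otimes>\<^bsub>M\<^esub> w g"
      have "y = (\<lambda>p\<in>?I. d1 G M ?v p \<otimes>\<^bsub>M\<^esub> z p)"
        unfolding y
        by (rule restrict_ext)
          (simp only: d1_mult[OF fn[OF v] fn[OF assms(1)]] eq M.m_assoc d[OF v] d[OF assms(1)] z)
      then show "y \<in> class2 G M z"
        unfolding c using C1_mult[OF v assms(1)] by blast
    qed
    show "class2 G M z \<subseteq> class2 G M z'"
    proof
      fix y assume "y \<in> class2 G M z"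
      then obtain v where v: "v \<in> C1 G M" and y: "y = (\<lambda>p\<in>?I. d1 G M v p \<otimes>\<^bsub>M\<^esub> z p)"
        unfolding c by blast
      let ?w = "\<lambda>g\<in>carrier G. inv\<^bsub>M\<^esub> w g"
      let ?v = "\<lambda>g\<in>carrier G. v g \<otimes>\<^bsub>M\<^esub> ?w g"
      have w: "?w \<in> C1 G M"
        using C1_inv assms(1) by blast
      have "d1 G M v p \<otimes>\<^bsub>M\<^esub> z p = d1 G M ?v p \<otimes>\<^bsub>M\<^esub> z' p" if p: "p \<in> ?I" for p
        unfolding d1_mult[OF fn[OF v] fn[OF w] p] d1_inv[OF fn[OF assms(1)] p] eq[OF p]
        using d[OF v p] d[OF assms(1) p] z[OF p]
        by (simp add: M.m_assoc M.l_inv_cancel)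
      then have "y = (\<lambda>p\<in>?I. d1 G M ?v p \<otimes>\<^bsub>M\<^esub> z' p)"
        unfolding y by (intro restrict_ext)
      then show "y \<in> class2 G M z'"
        unfolding c using C1_mult[OF v w] by blast
    qed
  qed
qed

end

text \<open>Evaluates the connecting map on one chosen lift \<open>b\<close>. The map
  \<open>r\<close> splits the sequence only as a sequence of spaces. It is used on values in the
  image of \<open>i\<close>, where it inverts \<open>i\<close>; hence \<open>i\<close> is injective,
  and cochains that factor through \<open>i\<close> pointwise do so continuously.\<close>

lemma connecting_class1:
  fixes G :: "('g, 'c) tgroup_scheme" and A :: "('g, 'm1, 'd1) gmod_scheme"
    and B :: "('g, 'm2, 'd2) gmod_scheme" and C :: "('g, 'm3, 'd3) gmod_scheme"
  assumes A: "top_gmodule G A" and B: "top_gmodule G B" and C: "comm_group C"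
    and i: "i \<in> hom A B"
    and i_act: "\<And>g x. \<lbrakk>g \<in> carrier G; x \<in> carrier A\<rbrakk> \<Longrightarrow> i (act A g x) = act B g (i x)"
    and r: "continuous_map (gtop B) (gtop A) r" "\<And>x. x \<in> carrier A \<Longrightarrow> r (i x) = x"
    and p: "p \<in> hom B C" "p ` carrier B = carrier C"
    and p_act: "\<And>g x. \<lbrakk>g \<in> carrier G; x \<in> carrier B\<rbrakk> \<Longrightarrow> p (act B g x) = act C g (p x)"
    and exact: "\<And>x. \<lbrakk>x \<in> carrier B; p x = \<one>\<^bsub>C\<^esub>\<rbrakk> \<Longrightarrow> x \<in> i ` carrier A"
    and c: "c \<in> extensional (carrier G)"
    and b: "b \<in> C1 G B" "\<And>g. g \<in> carrier G \<Longrightarrow> p (b g) = c g"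
    and z: "z \<in> carrier G \<times> carrier G \<rightarrow>\<^sub>E carrier A"
      "\<And>q. q \<in> carrier G \<times> carrier G \<Longrightarrow> i (z q) = d1 G B b q"
  shows "connecting G A B C i p (class1 G C c) = class2 G A z"
proof -
  interpret A: top_gmodule G A by fact
  interpret B: top_gmodule G B by fact
  interpret C: comm_group C by fact
  interpret i: group_hom A B i
    by unfold_locales (rule i)
  interpret p: group_hom B C p
    by unfold_locales (rule p)
  have inj: "x = y" if "x \<in> carrier A" "y \<in> carrier A" "i x = i y" for x y
    using r(2) that by metis
  have zA: "z q \<in> carrier A" if "q \<in> carrier G \<times> carrier G" for q
    using z(1) that by auto
  have bB: "b \<in> carrier G \<rightarrow> carrier B"
    using b(1) B.C1_closed by blast
  have i_d1: "i (d1 G A w q) = d1 G B (\<lambda>g\<in>carrier G. i (w g)) q"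
    if "w \<in> carrier G \<rightarrow> carrier A" "q \<in> carrier G \<times> carrier G" for w q
    using that by (auto simp: A.d1_apply B.d1_apply i_act Pi_iff)
  \<comment> \<open>Continuity holds because \<open>z\<close> is \<open>r\<close> after
    \<open>d1 G B b\<close>; the cocycle condition is tested after the injection \<open>i\<close>,
    where it becomes \<open>d2_d1\<close>.\<close>
  have zZ2: "z \<in> carrier (Z2 G A)"
  proof -
    have "continuous_map (prod_topology (gtop G) (gtop G)) (gtop A) (r \<circ> d1 G B b)"
      using B.d1_C2[OF b(1)] r(1) by (auto simp: C2_def intro: continuous_map_compose)
    then have "continuous_map (prod_topology (gtop G) (gtop G)) (gtop A) z"
      by (rule continuous_map_eq) (use z zA r(2) in \<open>force simp: A.topspace_G simp flip: z(2)\<close>)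
    moreover have "d2 G A z q = \<one>\<^bsub>A\<^esub>" if q: "q \<in> carrier G \<times> carrier G \<times> carrier G" for q
    proof (rule inj)
      obtain g h k where ghk: "q = (g, h, k)" "g \<in> carrier G" "h \<in> carrier G" "k \<in> carrier G"
        using q by auto
      show "d2 G A z q \<in> carrier A"
        using ghk zA by (simp add: d2_def)
      have "i (d2 G A z q) = d2 G B (d1 G B b) q"
        using ghk zA by (simp add: d2_def i_act z(2))
      then show "i (d2 G A z q) = i \<one>\<^bsub>A\<^esub>"
        using B.d2_d1[OF bB q] by simp
    qed simp
    ultimately show ?thesis
      using z(1) by (simp add: Z2_def C2_def)
  qed
  have class1: "class1 G C c = (\<lambda>y. \<lambda>g\<in>carrier G. d0 G C y g \<otimes>\<^bsub>C\<^esub> c g) ` carrier C"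
    by (auto simp: class1_def r_coset_def B1_def Z1_def image_iff)
  have cC: "c g \<in> carrier C" if "g \<in> carrier G" for g
    using b(2)[OF that, symmetric] bB that by (simp add: Pi_iff)
  have c_self: "c \<in> class1 G C c"
    unfolding class1
  proof (rule image_eqI)
    \<comment> \<open>Additivity of the action is available on \<open>B\<close>, so this is carried
      over to \<open>C\<close> along \<open>p\<close>.\<close>
    have "act C g \<one>\<^bsub>C\<^esub> = \<one>\<^bsub>C\<^esub>" if "g \<in> carrier G" for g
    proof -
      have "act B g \<one>\<^bsub>B\<^esub> = \<one>\<^bsub>B\<^esub>"
        using B.act_mult[OF that, of "\<one>\<^bsub>B\<^esub>" "\<one>\<^bsub>B\<^esub>"] that B.M.l_cancel_one by force
      then show ?thesis
        using p_act[OF that, of "\<one>\<^bsub>B\<^esub>"] by simp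
    qed
    then show "c = (\<lambda>g\<in>carrier G. d0 G C \<one>\<^bsub>C\<^esub> g \<otimes>\<^bsub>C\<^esub> c g)"
      using c cC by (intro extensionalityI[where A = "carrier G"]) (auto simp: d0_def)
  qed simp
  have zH2: "class2 G A z \<in> carrier (H2 G A)"
    using zZ2 by (auto simp: H2_def class2_def FactGroup_def RCOSETS_def)
  \<comment> \<open>For another choice, c' differs from c by the coboundary of some y. Lift y to Y:
    then \<open>v\<close>, the product of \<open>d0 Y\<close> and \<open>b\<close>, lifts c' and has
    the same coboundary as \<open>b\<close>. The quotient \<open>u\<close> of b' by \<open>v\<close>
    is trivial in \<open>C\<close>, so it is \<open>i\<close> of a continuous cochain
    \<open>w\<close>, and \<open>d1 w\<close> is the quotient of z' by \<open>z\<close>.\<close>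
  have unique: "class2 G A z' = class2 G A z"
    if c': "c' \<in> class1 G C c" and b': "b' \<in> C1 G B" and z': "z' \<in> carrier (Z2 G A)"
      and pb': "\<And>g. g \<in> carrier G \<Longrightarrow> p (b' g) = c' g"
      and iz': "\<And>q. q \<in> carrier G \<times> carrier G \<Longrightarrow> i (z' q) = d1 G B b' q" for c' b' z'
  proof -
    obtain y where "y \<in> carrier C" and y: "c' = (\<lambda>g\<in>carrier G. d0 G C y g \<otimes>\<^bsub>C\<^esub> c g)"
      using c' unfolding class1 by blast
    then obtain Y where Y: "Y \<in> carrier B" and "y = p Y"
      using p(2) by blast
    with y have c'_eq: "c' = (\<lambda>g\<in>carrier G. d0 G C (p Y) g \<otimes>\<^bsub>C\<^esub> c g)"
      by simp
    have b'B: "b' \<in> carrier G \<rightarrow> carrier B"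
      using b' B.C1_closed by blast
    define v where "v = (\<lambda>g\<in>carrier G. d0 G B Y g \<otimes>\<^bsub>B\<^esub> b g)"
    have v: "v \<in> C1 G B"
      unfolding v_def using B.C1_mult B.d0_C1 Y b(1) by blast
    then have vB: "v \<in> carrier G \<rightarrow> carrier B"
      using B.C1_closed by blast
    define v' where "v' = (\<lambda>g\<in>carrier G. inv\<^bsub>B\<^esub> v g)"
    have v': "v' \<in> C1 G B"
      unfolding v'_def using B.C1_inv v by blast
    then have v'B: "v' \<in> carrier G \<rightarrow> carrier B"
      using B.C1_closed by blast
    define u where "u = (\<lambda>g\<in>carrier G. b' g \<otimes>\<^bsub>B\<^esub> v' g)"
    have u: "u \<in> C1 G B"
      unfolding u_def using B.C1_mult b' v' by blast
    have pu: "p (u g) = \<one>\<^bsub>C\<^esub>" if g: "g \<in> carrier G" for g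
    proof -
      have "p (v g) = c' g"
        using g Y bB b(2)[OF g] by (simp add: v_def d0_def c'_eq p_act Pi_iff)
      moreover have "c' g \<in> carrier C"
        using p.hom_closed[of "b' g"] pb'[OF g] b'B g by (simp add: Pi_iff)
      ultimately show ?thesis
        using g vB b'B pb'[OF g] by (simp add: u_def v'_def Pi_iff)
    qed
    define w where "w = (\<lambda>g\<in>carrier G. r (u g))"
    have w: "w \<in> C1 G A"
      unfolding w_def
      using A.C1_restrictI[OF continuous_map_compose[OF B.C1_continuous[OF u] r(1)]]
      by (simp add: o_def)
    then have wA: "w \<in> carrier G \<rightarrow> carrier A"
      using A.C1_closed by blast
    have iw: "i (w g) = u g" if g: "g \<in> carrier G" for g
      using exact[OF B.C1_closed[OF u g] pu[OF g]] r(2) g by (auto simp: w_def)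
    show ?thesis
    proof (rule A.class2_eqI[OF w z(1)])
      show "z' \<in> extensional (carrier G \<times> carrier G)"
        using z' by (auto simp: Z2_def C2_def PiE_def)
      fix q assume q: "q \<in> carrier G \<times> carrier G"
      have z'A: "z' q \<in> carrier A"
        using z' q by (auto simp: Z2_def C2_def)
      have "(\<lambda>g\<in>carrier G. i (w g)) = u"
        using iw by (auto simp: u_def)
      then have "i (d1 G A w q) = d1 G B u q"
        using i_d1[OF wA q] by simp
      also have "\<dots> = d1 G B b' q \<otimes>\<^bsub>B\<^esub> inv\<^bsub>B\<^esub> d1 G B v q"
        unfolding u_def B.d1_mult[OF b'B v'B q] unfolding v'_def B.d1_inv[OF vB q] ..
      also have "d1 G B v q = d1 G B b q"
        unfolding v_def
        by (subst B.d1_mult[OF _ bB q]) (use B.d1_d0[OF Y q] B.C1_closed[OF B.d0_C1[OF Y]]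
            B.d1_closed[OF bB q] in auto)
      finally have "i (d1 G A w q \<otimes>\<^bsub>A\<^esub> z q) = i (z' q)"
        using A.d1_closed[OF wA q] zA[OF q] z'A B.M.inv_solve_right'
        by (simp add: z(2)[OF q, symmetric] iz'[OF q, symmetric] B.M.m_assoc)
      then show "z' q = d1 G A w q \<otimes>\<^bsub>A\<^esub> z q"
        using A.d1_closed[OF wA q] zA[OF q] z'A inj by (metis A.M.m_closed)
    qed
  qed
  show ?thesis
    unfolding connecting_def
  proof (rule the_equality)
    show "class2 G A z \<in> carrier (H2 G A) \<and>
       (\<exists>c\<in>class1 G C c. \<exists>b\<in>C1 G B. \<exists>z'\<in>carrier (Z2 G A).
        (\<forall>g\<in>carrier G. p (b g) = c g) \<and>
        (\<forall>q\<in>carrier G \<times> carrier G. i (z' q) = d1 G B b q) \<and> class2 G A z = class2 G A z')"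
      using zH2 c_self b z(2) zZ2 by (intro conjI bexI[of _ c] bexI[of _ b] bexI[of _ z]) auto
  next
    fix y
    assume "y \<in> carrier (H2 G A) \<and>
       (\<exists>c\<in>class1 G C c. \<exists>b\<in>C1 G B. \<exists>z'\<in>carrier (Z2 G A).
        (\<forall>g\<in>carrier G. p (b g) = c g) \<and>
        (\<forall>q\<in>carrier G \<times> carrier G. i (z' q) = d1 G B b q) \<and> y = class2 G A z')"
    then obtain c' b' z' where *: "c' \<in> class1 G C c" "b' \<in> C1 G B" "z' \<in> carrier (Z2 G A)"
      "\<forall>g\<in>carrier G. p (b' g) = c' g"
      "\<forall>q\<in>carrier G \<times> carrier G. i (z' q) = d1 G B b' q" "y = class2 G A z'"
      by (elim conjE bexE)
    then show "y = class2 G A z"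
      using unique[OF *(1-3) bspec[OF *(4)] bspec[OF *(5)]] *(6) by simp
  qed
qed

section \<open>Matrices over a module\<close>

text \<open>Keeps the sizes \<open>a + 1\<close> and \<open>b + 1\<close> of the blocks in this form under simplification.\<close>

declare One_nat_def [simp del]

section \<open>Finite sums in abelian monoids\<close>

lemma (in abelian_monoid) finsum_swap:
  assumes "finite A" "finite B" "\<And>i j. \<lbrakk>i \<in> A; j \<in> B\<rbrakk> \<Longrightarrow> f i j \<in> carrier G"
  shows "(\<Oplus>i\<in>A. \<Oplus>j\<in>B. f i j) = (\<Oplus>j\<in>B. \<Oplus>i\<in>A. f i j)"
  using assms
proof (induction A rule: finite_induct)
  case empty
  then show ?case by (simp add: finsum_zero)
next
  case (insert x F)
  have "(\<Oplus>i\<in>insert x F. \<Oplus>j\<in>B. f i j) = (\<Oplus>j\<in>B. f x j) \<oplus> (\<Oplus>j\<in>B. \<Oplus>i\<in>F. f i j)"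
    using insert by (subst finsum_insert) (auto intro!: finsum_closed)
  also have "\<dots> = (\<Oplus>j\<in>B. f x j \<oplus> (\<Oplus>i\<in>F. f i j))"
    using insert by (subst finsum_addf) (auto intro!: finsum_closed)
  also have "\<dots> = (\<Oplus>j\<in>B. \<Oplus>i\<in>insert x F. f i j)"
    using insert by (intro finsum_cong') (auto intro!: finsum_closed)
  finally show ?case .
qed

lemma (in abelian_monoid) finsum_hom:
  assumes f: "\<And>x. x \<in> carrier G \<Longrightarrow> f x \<in> carrier G"
    "\<And>x y. \<lbrakk>x \<in> carrier G; y \<in> carrier G\<rbrakk> \<Longrightarrow> f (x \<oplus> y) = f x \<oplus> f y" "f \<zero> = \<zero>"
    and "finite A" "c \<in> A \<rightarrow> carrier G"
  shows "f (\<Oplus>i\<in>A. c i) = (\<Oplus>i\<in>A. f (c i))"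
  using assms(4,5)
proof (induction A rule: finite_induct)
  case empty
  then show ?case by (simp add: f)
next
  case (insert x F)
  then show ?case
    by (simp add: f Pi_iff finsum_closed)
qed

lemma (in abelian_monoid) finsum_eq_single:
  assumes "finite A" "k \<in> A" "c \<in> A \<rightarrow> carrier G" "\<And>i. \<lbrakk>i \<in> A; i \<noteq> k\<rbrakk> \<Longrightarrow> c i = \<zero>"
  shows "(\<Oplus>i\<in>A. c i) = c k"
proof -
  have "(\<Oplus>i\<in>A. c i) = (\<Oplus>i\<in>A. if k = i then c i else \<zero>)"
    using assms by (intro finsum_cong') auto
  then show ?thesis
    using add.finprod_singleton assms by simp
qed

lemma (in abelian_monoid) finsum_eq_zero:
  assumes "\<And>i. i \<in> A \<Longrightarrow> c i = \<zero>"
  shows "(\<Oplus>i\<in>A. c i) = \<zero>"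
  using assms by (rule add.finprod_one_eqI)

section \<open>Matrix calculus over a module\<close>

abbreviation matrices :: "('s, 'e) partial_object_scheme \<Rightarrow> nat \<Rightarrow> nat \<Rightarrow> (nat \<times> nat \<Rightarrow> 's) set" where
  "matrices S m n \<equiv> mat_idx m n \<rightarrow>\<^sub>E carrier S"

lemma matrix_entry: "\<lbrakk>X \<in> matrices S m n; i \<in> {1..m}; j \<in> {1..n}\<rbrakk> \<Longrightarrow> X (i, j) \<in> carrier S"
  by (auto simp: mat_idx_def PiE_iff)

lemma matrix_eqI:
  assumes "X \<in> extensional (mat_idx m n)" "Y \<in> extensional (mat_idx m n)"
    and "\<And>i j. \<lbrakk>i \<in> {1..m}; j \<in> {1..n}\<rbrakk> \<Longrightarrow> X (i, j) = Y (i, j)"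
  shows "X = Y"
  using assms by (intro extensionalityI[of X "mat_idx m n"]) (auto simp: mat_idx_def)

lemma matrices_extensional: "X \<in> matrices S m n \<Longrightarrow> X \<in> extensional (mat_idx m n)"
  by (simp add: PiE_def)

lemma extensional_mat [simp]:
  "rmat_mult R k A B \<in> extensional (mat_idx k k)"
  "rmat_one R k \<in> extensional (mat_idx k k)"
  "mat_lmult T m n P X \<in> extensional (mat_idx m n)"
  "mat_rmult T m n X Q \<in> extensional (mat_idx m n)"
  "mat_add T' m n X Y \<in> extensional (mat_idx m n)"
  "mat_zero T' m n \<in> extensional (mat_idx m n)"
  "mat_act T'' m n g X \<in> extensional (mat_idx m n)"
  "mat_corner T' m n t \<in> extensional (mat_idx m n)"
  by (auto simp: rmat_mult_def rmat_one_def mat_lmult_def mat_rmult_def mat_add_def mat_zero_def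
      mat_act_def mat_corner_def)

text \<open>Later proofs select from this list by position: (1) and (2) concern square matrices over
  the ring, (3) and (4) left and right multiplication, (5) sums, (7) the action, (8) corner
  matrices.\<close>

lemma mat_apply:
  "\<lbrakk>i \<in> {1..k}; j \<in> {1..k}\<rbrakk> \<Longrightarrow> rmat_mult R k A B (i, j) = (\<Oplus>\<^bsub>R\<^esub>l\<in>{1..k}. A (i, l) \<otimes>\<^bsub>R\<^esub> B (l, j))"
  "\<lbrakk>i \<in> {1..k}; j \<in> {1..k}\<rbrakk> \<Longrightarrow> rmat_one R k (i, j) = (if i = j then \<one>\<^bsub>R\<^esub> else \<zero>\<^bsub>R\<^esub>)"
  "\<lbrakk>i \<in> {1..m}; j \<in> {1..n}\<rbrakk> \<Longrightarrow>
     mat_lmult T m n P X (i, j) = (\<Oplus>\<^bsub>T\<^esub>l\<in>{1..m}. P (i, l) \<odot>\<^bsub>T\<^esub> X (l, j))"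
  "\<lbrakk>i \<in> {1..m}; j \<in> {1..n}\<rbrakk> \<Longrightarrow>
     mat_rmult T m n X Q (i, j) = (\<Oplus>\<^bsub>T\<^esub>l\<in>{1..n}. Q (l, j) \<odot>\<^bsub>T\<^esub> X (i, l))"
  "\<lbrakk>i \<in> {1..m}; j \<in> {1..n}\<rbrakk> \<Longrightarrow> mat_add T' m n X Y (i, j) = X (i, j) \<oplus>\<^bsub>T'\<^esub> Y (i, j)"
  "\<lbrakk>i \<in> {1..m}; j \<in> {1..n}\<rbrakk> \<Longrightarrow> mat_zero T' m n (i, j) = \<zero>\<^bsub>T'\<^esub>"
  "\<lbrakk>i \<in> {1..m}; j \<in> {1..n}\<rbrakk> \<Longrightarrow> mat_act T'' m n g X (i, j) = mact T'' g (X (i, j))"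
  "\<lbrakk>i \<in> {1..m}; j \<in> {1..n}\<rbrakk> \<Longrightarrow> mat_corner T' m n t (i, j) = (if i = 1 \<and> j = n then t else \<zero>\<^bsub>T'\<^esub>)"
  by (simp_all add: rmat_mult_def rmat_one_def mat_lmult_def mat_rmult_def mat_add_def mat_zero_def
      mat_act_def mat_corner_def mat_idx_def)

lemma matricesI:
  assumes "X \<in> extensional (mat_idx m n)" "\<And>i j. \<lbrakk>i \<in> {1..m}; j \<in> {1..n}\<rbrakk> \<Longrightarrow> X (i, j) \<in> carrier S"
  shows "X \<in> matrices S m n"
  using assms by (auto simp: PiE_iff mat_idx_def)

context module begin

lemma finsum_smult_rdistr:
  assumes "finite A" "c \<in> A \<rightarrow> carrier R" "x \<in> carrier M"
  shows "(\<Oplus>\<^bsub>R\<^esub>i\<in>A. c i) \<odot>\<^bsub>M\<^esub> x = (\<Oplus>\<^bsub>M\<^esub>i\<in>A. c i \<odot>\<^bsub>M\<^esub> x)"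
  using assms
proof (induction A rule: finite_induct)
  case empty
  then show ?case by simp
next
  case (insert y F)
  then show ?case
    by (simp add: Pi_iff smult_l_distr M.finsum_insert R.finsum_insert R.finsum_closed)
qed

text \<open>The common core of associativity for left and for right multiplication: both expand to a
  nested sum of this shape.\<close>

lemma smult_finsum_finsum:
  assumes "finite A" "finite B" "\<And>l. l \<in> A \<Longrightarrow> c l \<in> carrier R"
    "\<And>l k. \<lbrakk>l \<in> A; k \<in> B\<rbrakk> \<Longrightarrow> d l k \<in> carrier R" "\<And>k. k \<in> B \<Longrightarrow> x k \<in> carrier M"
  shows "(\<Oplus>\<^bsub>M\<^esub>l\<in>A. c l \<odot>\<^bsub>M\<^esub> (\<Oplus>\<^bsub>M\<^esub>k\<in>B. d l k \<odot>\<^bsub>M\<^esub> x k)) =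
    (\<Oplus>\<^bsub>M\<^esub>k\<in>B. (\<Oplus>\<^bsub>R\<^esub>l\<in>A. c l \<otimes>\<^bsub>R\<^esub> d l k) \<odot>\<^bsub>M\<^esub> x k)"
proof -
  have "(\<Oplus>\<^bsub>M\<^esub>l\<in>A. c l \<odot>\<^bsub>M\<^esub> (\<Oplus>\<^bsub>M\<^esub>k\<in>B. d l k \<odot>\<^bsub>M\<^esub> x k)) =
      (\<Oplus>\<^bsub>M\<^esub>l\<in>A. \<Oplus>\<^bsub>M\<^esub>k\<in>B. (c l \<otimes>\<^bsub>R\<^esub> d l k) \<odot>\<^bsub>M\<^esub> x k)"
    using assms
    by (intro M.finsum_cong') (auto simp: finsum_smult_ldistr smult_assoc1 intro!: M.finsum_closed M.finsum_cong')
  also have "\<dots> = (\<Oplus>\<^bsub>M\<^esub>k\<in>B. \<Oplus>\<^bsub>M\<^esub>l\<in>A. (c l \<otimes>\<^bsub>R\<^esub> d l k) \<odot>\<^bsub>M\<^esub> x k)"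
    using assms by (intro M.finsum_swap) auto
  also have "\<dots> = (\<Oplus>\<^bsub>M\<^esub>k\<in>B. (\<Oplus>\<^bsub>R\<^esub>l\<in>A. c l \<otimes>\<^bsub>R\<^esub> d l k) \<odot>\<^bsub>M\<^esub> x k)"
    using assms by (intro M.finsum_cong') (auto simp: finsum_smult_rdistr intro!: R.finsum_closed)
  finally show ?thesis .
qed

lemma mat_lmult_closed:
  "\<lbrakk>P \<in> matrices R m m; X \<in> matrices M m n\<rbrakk> \<Longrightarrow> mat_lmult M m n P X \<in> matrices M m n"
  by (rule matricesI) (auto simp: mat_apply matrix_entry intro!: M.finsum_closed)

lemma mat_rmult_closed:
  "\<lbrakk>X \<in> matrices M m n; Q \<in> matrices R n n\<rbrakk> \<Longrightarrow> mat_rmult M m n X Q \<in> matrices M m n"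
  by (rule matricesI) (auto simp: mat_apply matrix_entry intro!: M.finsum_closed)

lemma mat_add_closed:
  "\<lbrakk>X \<in> matrices M m n; Y \<in> matrices M m n\<rbrakk> \<Longrightarrow> mat_add M m n X Y \<in> matrices M m n"
  by (rule matricesI) (auto simp: mat_apply matrix_entry)

lemma mat_zero_closed: "mat_zero M m n \<in> matrices M m n"
  by (rule matricesI) (auto simp: mat_apply)

lemma mat_corner_closed: "t \<in> carrier M \<Longrightarrow> mat_corner M m n t \<in> matrices M m n"
  by (rule matricesI) (auto simp: mat_apply)

lemma mat_lmult_lmult:
  assumes "P \<in> matrices R m m" "P' \<in> matrices R m m" "X \<in> matrices M m n"
  shows "mat_lmult M m n P (mat_lmult M m n P' X) = mat_lmult M m n (rmat_mult R m P P') X"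
proof (rule matrix_eqI)
  fix i j assume ij: "i \<in> {1..m}" "j \<in> {1..n}"
  have "mat_lmult M m n P (mat_lmult M m n P' X) (i, j) =
      (\<Oplus>\<^bsub>M\<^esub>l\<in>{1..m}. P (i, l) \<odot>\<^bsub>M\<^esub> (\<Oplus>\<^bsub>M\<^esub>k\<in>{1..m}. P' (l, k) \<odot>\<^bsub>M\<^esub> X (k, j)))"
    using assms ij
    by (auto simp: mat_apply matrix_entry intro!: M.finsum_cong' M.finsum_closed)
  also have "\<dots> = (\<Oplus>\<^bsub>M\<^esub>k\<in>{1..m}. (\<Oplus>\<^bsub>R\<^esub>l\<in>{1..m}. P (i, l) \<otimes>\<^bsub>R\<^esub> P' (l, k)) \<odot>\<^bsub>M\<^esub> X (k, j))"
    using assms ij by (intro smult_finsum_finsum) (auto simp: matrix_entry)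
  also have "\<dots> = mat_lmult M m n (rmat_mult R m P P') X (i, j)"
    using assms ij
    by (auto simp: mat_apply matrix_entry intro!: M.finsum_cong' R.finsum_closed)
  finally show "mat_lmult M m n P (mat_lmult M m n P' X) (i, j) =
      mat_lmult M m n (rmat_mult R m P P') X (i, j)" .
qed auto

lemma mat_rmult_rmult:
  assumes "X \<in> matrices M m n" "Q \<in> matrices R n n" "Q' \<in> matrices R n n"
  shows "mat_rmult M m n (mat_rmult M m n X Q) Q' = mat_rmult M m n X (rmat_mult R n Q Q')"
proof (rule matrix_eqI)
  fix i j assume ij: "i \<in> {1..m}" "j \<in> {1..n}"
  have "mat_rmult M m n (mat_rmult M m n X Q) Q' (i, j) =
      (\<Oplus>\<^bsub>M\<^esub>l\<in>{1..n}. Q' (l, j) \<odot>\<^bsub>M\<^esub> (\<Oplus>\<^bsub>M\<^esub>k\<in>{1..n}. Q (k, l) \<odot>\<^bsub>M\<^esub> X (i, k)))"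
    using assms ij
    by (auto simp: mat_apply matrix_entry intro!: M.finsum_cong' M.finsum_closed)
  also have "\<dots> = (\<Oplus>\<^bsub>M\<^esub>k\<in>{1..n}. (\<Oplus>\<^bsub>R\<^esub>l\<in>{1..n}. Q' (l, j) \<otimes>\<^bsub>R\<^esub> Q (k, l)) \<odot>\<^bsub>M\<^esub> X (i, k))"
    using assms ij by (intro smult_finsum_finsum) (auto simp: matrix_entry)
  \<comment> \<open>Scalars are written on the left even for right multiplication, so the factors
    arrive in reversed order; commutativity of \<open>R\<close> restores the matrix product.\<close>
  also have "\<dots> = (\<Oplus>\<^bsub>M\<^esub>k\<in>{1..n}. (\<Oplus>\<^bsub>R\<^esub>l\<in>{1..n}. Q (k, l) \<otimes>\<^bsub>R\<^esub> Q' (l, j)) \<odot>\<^bsub>M\<^esub> X (i, k))"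
    using assms ij
    by (intro M.finsum_cong' arg_cong2[where f = "smult M"] R.finsum_cong')
      (auto simp: matrix_entry R.m_comm intro!: R.finsum_closed)
  also have "\<dots> = mat_rmult M m n X (rmat_mult R n Q Q') (i, j)"
    using assms ij
    by (auto simp: mat_apply matrix_entry intro!: M.finsum_cong' R.finsum_closed)
  finally show "mat_rmult M m n (mat_rmult M m n X Q) Q' (i, j) =
      mat_rmult M m n X (rmat_mult R n Q Q') (i, j)" .
qed auto

text \<open>After the two sums are exchanged, the scalars from \<open>P\<close> and \<open>Q\<close>
  must pass each other, which is commutativity of \<open>R\<close>.\<close>

lemma mat_lmult_rmult:
  assumes "P \<in> matrices R m m" "X \<in> matrices M m n" "Q \<in> matrices R n n"
  shows "mat_lmult M m n P (mat_rmult M m n X Q) = mat_rmult M m n (mat_lmult M m n P X) Q"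
proof (rule matrix_eqI)
  fix i j assume ij: "i \<in> {1..m}" "j \<in> {1..n}"
  have "mat_lmult M m n P (mat_rmult M m n X Q) (i, j) =
      (\<Oplus>\<^bsub>M\<^esub>l\<in>{1..m}. \<Oplus>\<^bsub>M\<^esub>k\<in>{1..n}. P (i, l) \<odot>\<^bsub>M\<^esub> (Q (k, j) \<odot>\<^bsub>M\<^esub> X (l, k)))"
    using assms ij
    by (auto simp: mat_apply matrix_entry finsum_smult_ldistr intro!: M.finsum_cong' M.finsum_closed)
  also have "\<dots> = (\<Oplus>\<^bsub>M\<^esub>k\<in>{1..n}. \<Oplus>\<^bsub>M\<^esub>l\<in>{1..m}. P (i, l) \<odot>\<^bsub>M\<^esub> (Q (k, j) \<odot>\<^bsub>M\<^esub> X (l, k)))"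
    using assms ij by (intro M.finsum_swap) (auto simp: matrix_entry)
  also have "\<dots> = (\<Oplus>\<^bsub>M\<^esub>k\<in>{1..n}. \<Oplus>\<^bsub>M\<^esub>l\<in>{1..m}. Q (k, j) \<odot>\<^bsub>M\<^esub> (P (i, l) \<odot>\<^bsub>M\<^esub> X (l, k)))"
    using assms ij
    by (intro M.finsum_cong')
      (auto simp: matrix_entry R.m_comm simp flip: smult_assoc1 intro!: M.finsum_closed)
  also have "\<dots> = mat_rmult M m n (mat_lmult M m n P X) Q (i, j)"
    using assms ij
    by (auto simp: mat_apply matrix_entry finsum_smult_ldistr intro!: M.finsum_cong' M.finsum_closed)
  finally show "mat_lmult M m n P (mat_rmult M m n X Q) (i, j) =
      mat_rmult M m n (mat_lmult M m n P X) Q (i, j)" .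
qed auto

lemma mat_lmult_add:
  assumes "P \<in> matrices R m m" "X \<in> matrices M m n" "Y \<in> matrices M m n"
  shows "mat_lmult M m n P (mat_add M m n X Y) =
    mat_add M m n (mat_lmult M m n P X) (mat_lmult M m n P Y)"
proof (rule matrix_eqI)
  fix i j assume ij: "i \<in> {1..m}" "j \<in> {1..n}"
  have "mat_lmult M m n P (mat_add M m n X Y) (i, j) =
      (\<Oplus>\<^bsub>M\<^esub>l\<in>{1..m}. P (i, l) \<odot>\<^bsub>M\<^esub> X (l, j) \<oplus>\<^bsub>M\<^esub> P (i, l) \<odot>\<^bsub>M\<^esub> Y (l, j))"
    unfolding mat_apply(3)[OF ij] using assms ij
    by (intro M.finsum_cong') (auto simp: mat_apply matrix_entry smult_r_distr)
  also have "\<dots> = mat_add M m n (mat_lmult M m n P X) (mat_lmult M m n P Y) (i, j)"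
    using assms ij by (simp add: mat_apply matrix_entry M.finsum_addf)
  finally show "mat_lmult M m n P (mat_add M m n X Y) (i, j) =
      mat_add M m n (mat_lmult M m n P X) (mat_lmult M m n P Y) (i, j)" .
qed auto

lemma mat_rmult_add:
  assumes "Q \<in> matrices R n n" "X \<in> matrices M m n" "Y \<in> matrices M m n"
  shows "mat_rmult M m n (mat_add M m n X Y) Q =
    mat_add M m n (mat_rmult M m n X Q) (mat_rmult M m n Y Q)"
proof (rule matrix_eqI)
  fix i j assume ij: "i \<in> {1..m}" "j \<in> {1..n}"
  have "mat_rmult M m n (mat_add M m n X Y) Q (i, j) =
      (\<Oplus>\<^bsub>M\<^esub>l\<in>{1..n}. Q (l, j) \<odot>\<^bsub>M\<^esub> X (i, l) \<oplus>\<^bsub>M\<^esub> Q (l, j) \<odot>\<^bsub>M\<^esub> Y (i, l))"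
    unfolding mat_apply(4)[OF ij] using assms ij
    by (intro M.finsum_cong') (auto simp: mat_apply matrix_entry smult_r_distr)
  also have "\<dots> = mat_add M m n (mat_rmult M m n X Q) (mat_rmult M m n Y Q) (i, j)"
    using assms ij by (simp add: mat_apply matrix_entry M.finsum_addf)
  finally show "mat_rmult M m n (mat_add M m n X Y) Q (i, j) =
      mat_add M m n (mat_rmult M m n X Q) (mat_rmult M m n Y Q) (i, j)" .
qed auto

lemma mat_lmult_one:
  assumes "X \<in> matrices M m n"
  shows "mat_lmult M m n (rmat_one R m) X = X"
proof (rule matrix_eqI)
  fix i j assume ij: "i \<in> {1..m}" "j \<in> {1..n}"
  have "mat_lmult M m n (rmat_one R m) X (i, j) = rmat_one R m (i, i) \<odot>\<^bsub>M\<^esub> X (i, j)"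
    unfolding mat_apply(3)[OF ij]
    by (rule M.finsum_eq_single) (use assms ij in \<open>auto simp: mat_apply matrix_entry\<close>)
  then show "mat_lmult M m n (rmat_one R m) X (i, j) = X (i, j)"
    using assms ij by (simp add: mat_apply matrix_entry)
qed (use assms in \<open>auto simp: PiE_def\<close>)

lemma mat_rmult_one:
  assumes "X \<in> matrices M m n"
  shows "mat_rmult M m n X (rmat_one R n) = X"
proof (rule matrix_eqI)
  fix i j assume ij: "i \<in> {1..m}" "j \<in> {1..n}"
  have "mat_rmult M m n X (rmat_one R n) (i, j) = rmat_one R n (j, j) \<odot>\<^bsub>M\<^esub> X (i, j)"
    unfolding mat_apply(4)[OF ij]
    by (rule M.finsum_eq_single) (use assms ij in \<open>auto simp: mat_apply matrix_entry\<close>)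
  then show "mat_rmult M m n X (rmat_one R n) (i, j) = X (i, j)"
    using assms ij by (simp add: mat_apply matrix_entry)
qed (use assms in \<open>auto simp: PiE_def\<close>)

lemma mat_corner_add:
  assumes "s \<in> carrier M" "t \<in> carrier M"
  shows "mat_add M m n (mat_corner M m n s) (mat_corner M m n t) = mat_corner M m n (s \<oplus>\<^bsub>M\<^esub> t)"
  by (rule matrix_eqI[of _ m n]) (use assms in \<open>auto simp: mat_apply\<close>)

lemma mat_add_neg:
  assumes "X \<in> matrices M m n"
  shows "mat_add M m n (\<lambda>q\<in>mat_idx m n. \<ominus>\<^bsub>M\<^esub> X q) X = mat_zero M m n"
  unfolding mat_add_def mat_zero_def
  by (rule restrict_ext) (use assms in \<open>auto simp: PiE_iff M.l_neg\<close>)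

lemma comm_group_matrices:
  "comm_group \<lparr>carrier = matrices M m n, monoid.mult = mat_add M m n, one = mat_zero M m n, \<dots> = e\<rparr>"
proof (rule comm_groupI; simp)
  show "mat_add M m n X Y \<in> matrices M m n" if "X \<in> matrices M m n" "Y \<in> matrices M m n" for X Y
    using that by (rule mat_add_closed)
  show "mat_zero M m n \<in> matrices M m n"
    by (rule mat_zero_closed)
  show "mat_add M m n (mat_add M m n X Y) Z = mat_add M m n X (mat_add M m n Y Z)"
    if "X \<in> matrices M m n" "Y \<in> matrices M m n" "Z \<in> matrices M m n" for X Y Z
    by (rule matrix_eqI[of _ m n]) (use that in \<open>auto simp: mat_apply matrix_entry M.a_assoc\<close>)
  show "mat_add M m n X Y = mat_add M m n Y X"
    if "X \<in> matrices M m n" "Y \<in> matrices M m n" for X Y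
    by (rule matrix_eqI[of _ m n]) (use that in \<open>auto simp: mat_apply matrix_entry M.a_comm\<close>)
  show "mat_add M m n (mat_zero M m n) X = X" if "X \<in> matrices M m n" for X
    by (rule matrix_eqI[of _ m n]) (use that in \<open>auto simp: mat_apply matrix_entry PiE_def\<close>)
  show "\<exists>Y\<in>matrices M m n. mat_add M m n Y X = mat_zero M m n" if "X \<in> matrices M m n" for X
  proof
    show "(\<lambda>q\<in>mat_idx m n. \<ominus>\<^bsub>M\<^esub> X q) \<in> matrices M m n"
      using that by auto
    show "mat_add M m n (\<lambda>q\<in>mat_idx m n. \<ominus>\<^bsub>M\<^esub> X q) X = mat_zero M m n"
      using that by (rule mat_add_neg)
  qed
qed

end

section \<open>Unitriangular matrices over a commutative ring\<close>

lemma carrier_unitri: "carrier (unitri R k) = {A \<in> matrices R k k.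
    (\<forall>i\<in>{1..k}. A (i, i) = \<one>\<^bsub>R\<^esub>) \<and> (\<forall>i\<in>{1..k}. \<forall>j\<in>{1..k}. j < i \<longrightarrow> A (i, j) = \<zero>\<^bsub>R\<^esub>)}"
  by (simp add: unitri_def Let_def)

lemma mult_unitri [simp]: "(\<otimes>\<^bsub>unitri R k\<^esub>) = rmat_mult R k"
  by (simp add: unitri_def Let_def)

lemma one_unitri [simp]: "\<one>\<^bsub>unitri R k\<^esub> = rmat_one R k"
  by (simp add: unitri_def Let_def)

lemma unitri_matrix: "A \<in> carrier (unitri R k) \<Longrightarrow> A \<in> matrices R k k"
  by (simp add: carrier_unitri)

lemma unitri_diag: "\<lbrakk>A \<in> carrier (unitri R k); i \<in> {1..k}\<rbrakk> \<Longrightarrow> A (i, i) = \<one>\<^bsub>R\<^esub>"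
  by (simp add: carrier_unitri)

lemma unitri_lower: "\<lbrakk>A \<in> carrier (unitri R k); i \<in> {1..k}; j \<in> {1..k}; j < i\<rbrakk> \<Longrightarrow> A (i, j) = \<zero>\<^bsub>R\<^esub>"
  by (simp add: carrier_unitri)

lemma unitri_entry: "\<lbrakk>A \<in> carrier (unitri R k); i \<in> {1..k}; j \<in> {1..k}\<rbrakk> \<Longrightarrow> A (i, j) \<in> carrier R"
  using unitri_matrix matrix_entry by metis

text \<open>For closure under products: a term \<open>A (i, l) \<otimes> B (l, j)\<close> can be
  nonzero only if i \<le> l \<le> j. Below the diagonal no such l exists, and on it only l =
  i.\<close>

lemma monoid_unitri:
  fixes R :: "('r, 'd) tring_scheme" (structure)
  assumes "cring R"
  shows "monoid (unitri R k)"
proof -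
  interpret cring R by fact
  have mult: "rmat_mult R k A B \<in> carrier (unitri R k)"
    if A: "A \<in> carrier (unitri R k)" and B: "B \<in> carrier (unitri R k)" for A B
  proof -
    have c: "(\<lambda>l. A (i, l) \<otimes> B (l, j)) \<in> {1..k} \<rightarrow> carrier R" if "i \<in> {1..k}" "j \<in> {1..k}" for i j
      using that by (simp add: unitri_entry[OF A] unitri_entry[OF B])
    have "rmat_mult R k A B (i, i) = \<one>" if i: "i \<in> {1..k}" for i
    proof -
      have "rmat_mult R k A B (i, i) = A (i, i) \<otimes> B (i, i)"
        unfolding mat_apply(1)[OF i i]
      proof (rule finsum_eq_single)
        fix l assume l: "l \<in> {1..k}" "l \<noteq> i"
        then have "l < i \<or> i < l" by auto
        then show "A (i, l) \<otimes> B (l, i) = \<zero>"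
          using unitri_lower[OF A i l(1)] unitri_lower[OF B l(1) i]
            unitri_entry[OF A i l(1)] unitri_entry[OF B l(1) i] by auto
      qed (use i c in auto)
      then show ?thesis
        using unitri_diag[OF A i] unitri_diag[OF B i] by simp
    qed
    moreover have "rmat_mult R k A B (i, j) = \<zero>" if i: "i \<in> {1..k}" and j: "j \<in> {1..k}" and "j < i" for i j
      unfolding mat_apply(1)[OF i j]
    proof (rule finsum_eq_zero)
      fix l assume l: "l \<in> {1..k}"
      have "l < i \<or> j < l" using \<open>j < i\<close> by auto
      then show "A (i, l) \<otimes> B (l, j) = \<zero>"
        using unitri_lower[OF A i l] unitri_lower[OF B l j]
          unitri_entry[OF A i l] unitri_entry[OF B l j] by auto
    qed
    moreover have "rmat_mult R k A B \<in> matrices R k k"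
      by (rule matricesI) (use c in \<open>auto simp: mat_apply intro!: finsum_closed\<close>)
    ultimately show ?thesis
      by (auto simp: carrier_unitri)
  qed
  show ?thesis
  proof (rule monoidI; simp)
    show "rmat_mult R k A B \<in> carrier (unitri R k)"
      if "A \<in> carrier (unitri R k)" "B \<in> carrier (unitri R k)" for A B
      using that by (rule mult)
    show "rmat_one R k \<in> carrier (unitri R k)"
      by (auto simp: carrier_unitri mat_apply intro!: matricesI)
    show "rmat_mult R k (rmat_mult R k A B) C = rmat_mult R k A (rmat_mult R k B C)"
      if A: "A \<in> carrier (unitri R k)" and B: "B \<in> carrier (unitri R k)" and C: "C \<in> carrier (unitri R k)"
      for A B C
    proof (rule matrix_eqI)
      fix i j assume i: "i \<in> {1..k}" and j: "j \<in> {1..k}"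
      have "rmat_mult R k (rmat_mult R k A B) C (i, j) =
          (\<Oplus>l\<in>{1..k}. \<Oplus>h\<in>{1..k}. A (i, h) \<otimes> (B (h, l) \<otimes> C (l, j)))"
        unfolding mat_apply(1)[OF i j]
        by (rule finsum_cong')
          (use i j in \<open>auto simp: unitri_entry[OF A] unitri_entry[OF B] unitri_entry[OF C] mat_apply finsum_ldistr m_assoc intro!: finsum_closed finsum_cong'\<close>)
      also have "\<dots> = (\<Oplus>h\<in>{1..k}. \<Oplus>l\<in>{1..k}. A (i, h) \<otimes> (B (h, l) \<otimes> C (l, j)))"
        by (rule finsum_swap) (use i j in \<open>auto simp: unitri_entry[OF A] unitri_entry[OF B] unitri_entry[OF C]\<close>)
      also have "\<dots> = rmat_mult R k A (rmat_mult R k B C) (i, j)"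
        unfolding mat_apply(1)[OF i j]
        by (rule finsum_cong')
          (use i j in \<open>auto simp: unitri_entry[OF A] unitri_entry[OF B] unitri_entry[OF C] mat_apply finsum_rdistr intro!: finsum_closed finsum_cong'\<close>)
      finally show "rmat_mult R k (rmat_mult R k A B) C (i, j) =
          rmat_mult R k A (rmat_mult R k B C) (i, j)" .
    qed auto
    show "rmat_mult R k (rmat_one R k) A = A" if A: "A \<in> carrier (unitri R k)" for A
    proof (rule matrix_eqI)
      fix i j assume i: "i \<in> {1..k}" and j: "j \<in> {1..k}"
      have "rmat_mult R k (rmat_one R k) A (i, j) = rmat_one R k (i, i) \<otimes> A (i, j)"
        unfolding mat_apply(1)[OF i j]
        by (rule finsum_eq_single) (use i j in \<open>auto simp: unitri_entry[OF A] mat_apply\<close>)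
      then show "rmat_mult R k (rmat_one R k) A (i, j) = A (i, j)"
        using unitri_entry[OF A i j] i by (simp add: mat_apply)
    qed (use unitri_matrix[OF A] in \<open>auto simp: PiE_def\<close>)
    show "rmat_mult R k A (rmat_one R k) = A" if A: "A \<in> carrier (unitri R k)" for A
    proof (rule matrix_eqI)
      fix i j assume i: "i \<in> {1..k}" and j: "j \<in> {1..k}"
      have "rmat_mult R k A (rmat_one R k) (i, j) = A (i, j) \<otimes> rmat_one R k (j, j)"
        unfolding mat_apply(1)[OF i j]
        by (rule finsum_eq_single) (use i j in \<open>auto simp: unitri_entry[OF A] mat_apply\<close>)
      then show "rmat_mult R k A (rmat_one R k) (i, j) = A (i, j)"
        using unitri_entry[OF A i j] j by (simp add: mat_apply)
    qed (use unitri_matrix[OF A] in \<open>auto simp: PiE_def\<close>)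
  qed
qed

text \<open>This makes \<open>\<theta> 1\<close> the identity, hence \<open>\<theta>(g)\<^sup>-\<^sup>1 = \<theta>(g\<^sup>-\<^sup>1)\<close>, without knowing that \<open>unitri R k\<close> has inverses.\<close>

lemma unitri_idempotent:
  fixes R :: "('r, 'd) tring_scheme" (structure)
  assumes "cring R" and A: "A \<in> carrier (unitri R k)" and idem: "rmat_mult R k A A = A"
  shows "A = rmat_one R k"
proof -
  interpret cring R by fact
  have zero: "A (i, j) = \<zero>" if "i \<in> {1..k}" "j \<in> {1..k}" "i < j" for i j
    using that
  \<comment> \<open>Induction on the distance from the diagonal. In the entry \<open>(i, j)\<close>
    of the square, terms with l strictly between i and j vanish by induction and those with l
    outside vanish by triangularity, so idempotency becomes
    \<open>A (i, j) = A (i, j) \<oplus> A (i, j)\<close>.\<close>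
  proof (induction "j - i" arbitrary: j rule: less_induct)
    case less
    note i = less.prems(1) and j = less.prems(2)
    have Aij: "A (i, j) \<in> carrier R"
      using unitri_entry[OF A i j] .
    have vanish: "A (i, l) \<otimes> A (l, j) = \<zero>" if l: "l \<in> {1..k} - {i, j}" for l
    proof -
      have l': "l \<in> {1..k}" using l by auto
      have "A (i, l) = \<zero> \<or> A (l, j) = \<zero>"
      proof (cases "l < i \<or> j < l")
        case True
        then show ?thesis
          using unitri_lower[OF A i l'] unitri_lower[OF A l' j] by auto
      next
        case False
        then have "i < l" "l < j" using l by auto
        then show ?thesis
          using less.hyps[of l] i l' by auto
      qed
      then show ?thesis
        using unitri_entry[OF A i l'] unitri_entry[OF A l' j] by auto
    qed
    have "A (i, j) = (\<Oplus>l\<in>{1..k}. A (i, l) \<otimes> A (l, j))"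
      using mat_apply(1)[OF i j, of R A A] idem by simp
    also have "\<dots> = (\<Oplus>l\<in>{i, j}. A (i, l) \<otimes> A (l, j))"
      by (rule add.finprod_mono_neutral_cong_right)
        (use i j vanish in \<open>auto simp: unitri_entry[OF A]\<close>)
    also have "\<dots> = A (i, i) \<otimes> A (i, j) \<oplus> A (i, j) \<otimes> A (j, j)"
      using less.prems by (subst finsum_insert) (auto simp: unitri_entry[OF A])
    also have "\<dots> = A (i, j) \<oplus> A (i, j)"
      using unitri_diag[OF A i] unitri_diag[OF A j] Aij by simp
    finally show ?case
      using Aij by (metis add.l_cancel_one)
  qed
  show ?thesis
  proof (rule matrix_eqI)
    fix i j assume ij: "i \<in> {1..k}" "j \<in> {1..k}"
    consider "i = j" | "i < j" | "j < i" by linarith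
    then show "A (i, j) = rmat_one R k (i, j)"
      using unitri_diag[OF A ij(1)] unitri_lower[OF A ij] zero[OF ij] ij by cases (auto simp: mat_apply)
  qed (use unitri_matrix[OF A] in \<open>auto simp: PiE_def\<close>)
qed

lemma unitri_hom_one:
  fixes R :: "('r, 'd) tring_scheme"
  assumes "cring R" "group G" "f \<in> hom G (unitri R k)"
  shows "f \<one>\<^bsub>G\<^esub> = rmat_one R k"
proof (rule unitri_idempotent)
  interpret group G by fact
  show "f \<one>\<^bsub>G\<^esub> \<in> carrier (unitri R k)"
    using assms(3) by (auto simp: hom_def)
  show "rmat_mult R k (f \<one>\<^bsub>G\<^esub>) (f \<one>\<^bsub>G\<^esub>) = f \<one>\<^bsub>G\<^esub>"
    using hom_mult[OF assms(3), of "\<one>\<^bsub>G\<^esub>" "\<one>\<^bsub>G\<^esub>"] by simp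
qed fact

lemma unitri_hom_inv:
  fixes R :: "('r, 'd) tring_scheme"
  assumes "cring R" "group G" "f \<in> hom G (unitri R k)" "g \<in> carrier G"
  shows "inv\<^bsub>unitri R k\<^esub> (f g) = f (inv\<^bsub>G\<^esub> g)"
proof -
  interpret group G by fact
  interpret U: monoid "unitri R k"
    by (rule monoid_unitri) fact
  have "f \<one>\<^bsub>G\<^esub> = \<one>\<^bsub>unitri R k\<^esub>"
    using unitri_hom_one[OF assms(1-3)] by simp
  then show ?thesis
    using assms(3,4) hom_mult[OF assms(3), of g "inv\<^bsub>G\<^esub> g"] hom_mult[OF assms(3), of "inv\<^bsub>G\<^esub> g" g]
    by (intro U.inv_char) (auto simp: hom_def simp del: mult_unitri one_unitri)
qed

section \<open>Topology of matrix modules and quotients\<close>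

text \<open>Without this the \<open>topology\<close> constructor in \<open>quot_gmod\<close> gives
  no control over its open sets; with it, \<open>openin\<close> on the quotient unfolds to openness
  of the preimage.\<close>

lemma istopology_quot:
  "istopology (\<lambda>V. V \<subseteq> K \<and> openin X {x \<in> topspace X. f x \<in> V})"
  unfolding istopology_def
proof (intro conjI allI impI; (elim conjE)?)
  fix S T assume "openin X {x \<in> topspace X. f x \<in> S}" "openin X {x \<in> topspace X. f x \<in> T}"
  then have "openin X ({x \<in> topspace X. f x \<in> S} \<inter> {x \<in> topspace X. f x \<in> T})"
    by (rule openin_Int)
  moreover have "{x \<in> topspace X. f x \<in> S \<inter> T} = {x \<in> topspace X. f x \<in> S} \<inter> {x \<in> topspace X. f x \<in> T}"
    by auto
  ultimately show "openin X {x \<in> topspace X. f x \<in> S \<inter> T}"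
    by (simp only:)
next
  fix \<K> assume *: "\<forall>S\<in>\<K>. S \<subseteq> K \<and> openin X {x \<in> topspace X. f x \<in> S}"
  then show "\<Union>\<K> \<subseteq> K" by auto
  have "{x \<in> topspace X. f x \<in> \<Union>\<K>} = (\<Union>S\<in>\<K>. {x \<in> topspace X. f x \<in> S})"
    by auto
  then show "openin X {x \<in> topspace X. f x \<in> \<Union>\<K>}"
    using * by auto
qed auto

lemma openin_quot_gmod:
  "openin (gtop (quot_gmod M N)) V \<longleftrightarrow>
     V \<subseteq> carrier (M Mod N) \<and> openin (gtop M) {x \<in> topspace (gtop M). N #>\<^bsub>M\<^esub> x \<in> V}"
  unfolding quot_gmod_def by (simp add: topology_inverse'[OF istopology_quot])

lemma carrier_quot_gmod: "carrier (quot_gmod M N) = (\<lambda>x. N #>\<^bsub>M\<^esub> x) ` carrier M"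
  by (auto simp: quot_gmod_def FactGroup_def RCOSETS_def)

lemma quot_gmod_simps [simp]:
  "mult (quot_gmod M N) = (<#>\<^bsub>M\<^esub>)" "one (quot_gmod M N) = N"
  "act (quot_gmod M N) = (\<lambda>g Y. act M g ` Y)"
  by (auto simp: quot_gmod_def FactGroup_def)

lemma topspace_quot_gmod:
  assumes "topspace (gtop M) = carrier M"
  shows "topspace (gtop (quot_gmod M N)) = carrier (quot_gmod M N)"
proof -
  let ?K = "carrier (M Mod N)"
  have "N #>\<^bsub>M\<^esub> x \<in> ?K" if "x \<in> carrier M" for x
    using that by (auto simp: FactGroup_def RCOSETS_def)
  then have "openin (gtop (quot_gmod M N)) ?K"
    using openin_topspace[of "gtop M"] assms by (auto simp: openin_quot_gmod cong: conj_cong)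
  then have "topspace (gtop (quot_gmod M N)) = ?K"
    using openin_quot_gmod[of M N "topspace (gtop (quot_gmod M N))"]
    by (intro subset_antisym openin_subset) simp_all
  then show ?thesis
    by (simp add: quot_gmod_def)
qed

lemma continuous_into_quot_gmod:
  assumes M: "topspace (gtop M) = carrier M" and f: "continuous_map X (gtop M) f"
  shows "continuous_map X (gtop (quot_gmod M N)) (\<lambda>x. N #>\<^bsub>M\<^esub> f x)"
proof -
  have "continuous_map (gtop M) (gtop (quot_gmod M N)) (\<lambda>x. N #>\<^bsub>M\<^esub> x)"
    using M by (auto simp: continuous_map_def openin_quot_gmod topspace_quot_gmod[OF M] carrier_quot_gmod)
  from continuous_map_compose[OF f this] show ?thesis
    by (simp add: o_def)
qed

text \<open>The universal property of the quotient topology. It makes the entries of a class modulo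
  \<open>T\<close>, away from the corner, continuous functions of the class.\<close>

lemma continuous_from_quot_gmod:
  assumes M: "topspace (gtop M) = carrier M" and f: "continuous_map (gtop M) Y f"
    and F: "\<And>x. x \<in> carrier M \<Longrightarrow> F (N #>\<^bsub>M\<^esub> x) = f x"
  shows "continuous_map (gtop (quot_gmod M N)) Y F"
  unfolding continuous_map_def
proof (intro conjI allI impI)
  show "F \<in> topspace (gtop (quot_gmod M N)) \<rightarrow> topspace Y"
    using f F by (auto simp: topspace_quot_gmod[OF M] carrier_quot_gmod continuous_map_def M)
  fix V assume "openin Y V"
  then have "openin (gtop M) {x \<in> topspace (gtop M). f x \<in> V}"
    using f by (auto simp: continuous_map_def)
  moreover have "{x \<in> topspace (gtop M). f x \<in> V} = {x \<in> topspace (gtop M).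
      N #>\<^bsub>M\<^esub> x \<in> {C \<in> topspace (gtop (quot_gmod M N)). F C \<in> V}}"
    using F by (auto simp: topspace_quot_gmod[OF M] carrier_quot_gmod M)
  moreover have "{C \<in> topspace (gtop (quot_gmod M N)). F C \<in> V} \<subseteq> carrier (M Mod N)"
    by (auto simp: topspace_quot_gmod[OF M]) (simp add: quot_gmod_def)
  ultimately show "openin (gtop (quot_gmod M N)) {C \<in> topspace (gtop (quot_gmod M N)). F C \<in> V}"
    by (simp add: openin_quot_gmod)
qed

text \<open>Records with the same operations may differ in their topology and action fields, hence
  in type; this transfers the group laws between them.\<close>

lemma comm_group_cong:
  assumes "comm_group H" and K: "carrier K = carrier H" "mult K = mult H" "one K = one H"
  shows "comm_group K"
proof -
  interpret comm_group H by fact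
  show ?thesis
    by (rule comm_groupI) (auto simp: K m_ac intro: l_inv_ex)
qed

lemma comm_group_quot_gmod:
  assumes "comm_group M" "subgroup N M"
  shows "comm_group (quot_gmod M N)"
proof -
  interpret comm_group M by fact
  have "comm_group (M Mod N)"
    using assms(2) by (rule abelian_FactGroup)
  then show ?thesis
    by (rule comm_group_cong) (auto simp: quot_gmod_def)
qed

section \<open>Matrices over a compact module: action, corner matrices, continuity\<close>

locale rg_module =
  fixes G :: "('g, 'c) tgroup_scheme" and R :: "('r, 'd) tring_scheme" and T :: "('g, 'r, 't, 'e) rgmod_scheme"
  assumes profinite_R: "profinite_cring R" and profinite_G: "profinite_group G"
    and compact_T: "compact_RG_module G R T"
begin

sublocale T: module R T
  using compact_T by (simp add: compact_RG_module_def)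

sublocale G: group G
  using profinite_G by (simp add: profinite_group_def)

lemma topspaces:
  "topspace (gtop G) = carrier G" "topspace (rtop R) = carrier R" "topspace (mtop T) = carrier T"
  using profinite_G profinite_R compact_T
  by (simp_all add: profinite_group_def profinite_cring_def compact_RG_module_def)

lemma mact_one: "x \<in> carrier T \<Longrightarrow> mact T \<one>\<^bsub>G\<^esub> x = x"
  and mact_mact: "\<lbrakk>g \<in> carrier G; h \<in> carrier G; x \<in> carrier T\<rbrakk> \<Longrightarrow>
    mact T (g \<otimes>\<^bsub>G\<^esub> h) x = mact T g (mact T h x)"
  and mact_add: "\<lbrakk>g \<in> carrier G; x \<in> carrier T; y \<in> carrier T\<rbrakk> \<Longrightarrow>
    mact T g (x \<oplus>\<^bsub>T\<^esub> y) = mact T g x \<oplus>\<^bsub>T\<^esub> mact T g y"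
  and mact_smult: "\<lbrakk>g \<in> carrier G; r \<in> carrier R; x \<in> carrier T\<rbrakk> \<Longrightarrow>
    mact T g (r \<odot>\<^bsub>T\<^esub> x) = r \<odot>\<^bsub>T\<^esub> mact T g x"
  using compact_T by (simp_all add: compact_RG_module_def)

lemma mact_closed [simp]: "\<lbrakk>g \<in> carrier G; x \<in> carrier T\<rbrakk> \<Longrightarrow> mact T g x \<in> carrier T"
proof -
  have "continuous_map (prod_topology (gtop G) (mtop T)) (mtop T) (\<lambda>(g, x). mact T g x)"
    using compact_T by (simp add: compact_RG_module_def)
  then show "\<lbrakk>g \<in> carrier G; x \<in> carrier T\<rbrakk> \<Longrightarrow> mact T g x \<in> carrier T"
    using continuous_map_image_subset_topspace by (fastforce simp: topspaces)
qed

lemma mact_zero [simp]: "g \<in> carrier G \<Longrightarrow> mact T g \<zero>\<^bsub>T\<^esub> = \<zero>\<^bsub>T\<^esub>"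
  using mact_add[of g "\<zero>\<^bsub>T\<^esub>" "\<zero>\<^bsub>T\<^esub>"] T.M.add.l_cancel_one[of "mact T g \<zero>\<^bsub>T\<^esub>" "mact T g \<zero>\<^bsub>T\<^esub>"] by simp

lemma mact_finsum:
  "\<lbrakk>g \<in> carrier G; finite A; c \<in> A \<rightarrow> carrier T\<rbrakk> \<Longrightarrow>
    mact T g (\<Oplus>\<^bsub>T\<^esub>i\<in>A. c i) = (\<Oplus>\<^bsub>T\<^esub>i\<in>A. mact T g (c i))"
  by (rule T.M.finsum_hom) (auto simp: mact_add)

lemma mat_act_closed: "\<lbrakk>g \<in> carrier G; X \<in> matrices T m n\<rbrakk> \<Longrightarrow> mat_act T m n g X \<in> matrices T m n"
  by (rule matricesI) (auto simp: mat_apply matrix_entry)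

lemma mat_act_one: "X \<in> matrices T m n \<Longrightarrow> mat_act T m n \<one>\<^bsub>G\<^esub> X = X"
  by (rule matrix_eqI[of _ m n]) (auto simp: mat_apply matrix_entry mact_one matrices_extensional)

lemma mat_act_act: "\<lbrakk>g \<in> carrier G; h \<in> carrier G; X \<in> matrices T m n\<rbrakk> \<Longrightarrow>
    mat_act T m n (g \<otimes>\<^bsub>G\<^esub> h) X = mat_act T m n g (mat_act T m n h X)"
  by (rule matrix_eqI[of _ m n]) (auto simp: mat_apply matrix_entry mact_mact)

lemma mat_act_add: "\<lbrakk>g \<in> carrier G; X \<in> matrices T m n; Y \<in> matrices T m n\<rbrakk> \<Longrightarrow>
    mat_act T m n g (mat_add T m n X Y) = mat_add T m n (mat_act T m n g X) (mat_act T m n g Y)"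
  by (rule matrix_eqI[of _ m n]) (auto simp: mat_apply matrix_entry mact_add)

lemma mat_act_corner: "\<lbrakk>g \<in> carrier G; t \<in> carrier T\<rbrakk> \<Longrightarrow>
    mat_act T m n g (mat_corner T m n t) = mat_corner T m n (mact T g t)"
  by (rule matrix_eqI[of _ m n]) (auto simp: mat_apply)

lemma mat_act_lmult:
  assumes "g \<in> carrier G" "P \<in> matrices R m m" "X \<in> matrices T m n"
  shows "mat_act T m n g (mat_lmult T m n P X) = mat_lmult T m n P (mat_act T m n g X)"
proof (rule matrix_eqI)
  fix i j assume ij: "i \<in> {1..m}" "j \<in> {1..n}"
  have "mat_act T m n g (mat_lmult T m n P X) (i, j) = (\<Oplus>\<^bsub>T\<^esub>l\<in>{1..m}. mact T g (P (i, l) \<odot>\<^bsub>T\<^esub> X (l, j)))"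
    unfolding mat_apply(7)[OF ij] mat_apply(3)[OF ij]
    by (rule mact_finsum) (use assms ij in \<open>auto simp: matrix_entry\<close>)
  also have "\<dots> = mat_lmult T m n P (mat_act T m n g X) (i, j)"
    unfolding mat_apply(3)[OF ij]
    by (rule T.M.finsum_cong') (use assms ij in \<open>auto simp: mat_apply matrix_entry mact_smult\<close>)
  finally show "mat_act T m n g (mat_lmult T m n P X) (i, j) = mat_lmult T m n P (mat_act T m n g X) (i, j)" .
qed auto

lemma mat_act_rmult:
  assumes "g \<in> carrier G" "Q \<in> matrices R n n" "X \<in> matrices T m n"
  shows "mat_act T m n g (mat_rmult T m n X Q) = mat_rmult T m n (mat_act T m n g X) Q"
proof (rule matrix_eqI)
  fix i j assume ij: "i \<in> {1..m}" "j \<in> {1..n}"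
  have "mat_act T m n g (mat_rmult T m n X Q) (i, j) = (\<Oplus>\<^bsub>T\<^esub>l\<in>{1..n}. mact T g (Q (l, j) \<odot>\<^bsub>T\<^esub> X (i, l)))"
    unfolding mat_apply(7)[OF ij] mat_apply(4)[OF ij]
    by (rule mact_finsum) (use assms ij in \<open>auto simp: matrix_entry\<close>)
  also have "\<dots> = mat_rmult T m n (mat_act T m n g X) Q (i, j)"
    unfolding mat_apply(4)[OF ij]
    by (rule T.M.finsum_cong') (use assms ij in \<open>auto simp: mat_apply matrix_entry mact_smult\<close>)
  finally show "mat_act T m n g (mat_rmult T m n X Q) (i, j) = mat_rmult T m n (mat_act T m n g X) Q (i, j)" .
qed auto

text \<open>Only the first column of \<open>P\<close> meets the nonzero entry, and it is the first
  unit vector. Together with the mirror statement for \<open>Q\<close>, whose last row is the last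
  unit vector, this makes the twist by \<open>\<phi>\<close> and \<open>\<theta>\<close> invisible
  on \<open>T\<close>.\<close>

lemma mat_lmult_corner:
  assumes "P \<in> carrier (unitri R m)" "t \<in> carrier T" "m \<ge> 1"
  shows "mat_lmult T m n P (mat_corner T m n t) = mat_corner T m n t"
proof (rule matrix_eqI)
  fix i j assume ij: "i \<in> {1..m}" "j \<in> {1..n}"
  have "mat_lmult T m n P (mat_corner T m n t) (i, j) = P (i, 1) \<odot>\<^bsub>T\<^esub> mat_corner T m n t (1, j)"
    unfolding mat_apply(3)[OF ij]
    by (rule T.M.finsum_eq_single)
      (use assms ij unitri_entry[OF assms(1)] in \<open>auto simp: mat_apply\<close>)
  also have "\<dots> = mat_corner T m n t (i, j)"
  proof (cases "i = 1")
    case True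
    then show ?thesis
      using assms ij unitri_diag[OF assms(1), of 1] by (auto simp: mat_apply)
  next
    case False
    then show ?thesis
      using assms ij unitri_lower[OF assms(1), of i 1] by (auto simp: mat_apply)
  qed
  finally show "mat_lmult T m n P (mat_corner T m n t) (i, j) = mat_corner T m n t (i, j)" .
qed auto

lemma mat_rmult_corner:
  assumes "Q \<in> carrier (unitri R n)" "t \<in> carrier T" "n \<ge> 1"
  shows "mat_rmult T m n (mat_corner T m n t) Q = mat_corner T m n t"
proof (rule matrix_eqI)
  fix i j assume ij: "i \<in> {1..m}" "j \<in> {1..n}"
  have "mat_rmult T m n (mat_corner T m n t) Q (i, j) = Q (n, j) \<odot>\<^bsub>T\<^esub> mat_corner T m n t (i, n)"
    unfolding mat_apply(4)[OF ij]
    by (rule T.M.finsum_eq_single)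
      (use assms ij unitri_entry[OF assms(1)] in \<open>auto simp: mat_apply\<close>)
  also have "\<dots> = mat_corner T m n t (i, j)"
  proof (cases "j = n")
    case True
    then show ?thesis
      using assms ij unitri_diag[OF assms(1), of n] by (auto simp: mat_apply)
  next
    case False
    then show ?thesis
      using assms ij unitri_lower[OF assms(1), of n j] by (auto simp: mat_apply)
  qed
  finally show "mat_rmult T m n (mat_corner T m n t) Q (i, j) = mat_corner T m n t (i, j)" .
qed auto

lemma continuous_add:
  assumes "continuous_map X (mtop T) f" "continuous_map X (mtop T) f'"
  shows "continuous_map X (mtop T) (\<lambda>x. f x \<oplus>\<^bsub>T\<^esub> f' x)"
proof -
  have "continuous_map (prod_topology (mtop T) (mtop T)) (mtop T) (\<lambda>(x, y). x \<oplus>\<^bsub>T\<^esub> y)"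
    using compact_T by (simp add: compact_RG_module_def)
  from continuous_map_compose[OF continuous_map_pairedI[OF assms] this] show ?thesis
    by (simp add: o_def)
qed

lemma continuous_neg:
  assumes "continuous_map X (mtop T) f"
  shows "continuous_map X (mtop T) (\<lambda>x. \<ominus>\<^bsub>T\<^esub> f x)"
proof -
  have "continuous_map (mtop T) (mtop T) (\<lambda>x. \<ominus>\<^bsub>T\<^esub> x)"
    using compact_T by (simp add: compact_RG_module_def)
  from continuous_map_compose[OF assms this] show ?thesis
    by (simp add: o_def)
qed

lemma continuous_smult:
  assumes "continuous_map X (rtop R) c" "continuous_map X (mtop T) f"
  shows "continuous_map X (mtop T) (\<lambda>x. c x \<odot>\<^bsub>T\<^esub> f x)"
proof -
  have "continuous_map (prod_topology (rtop R) (mtop T)) (mtop T) (\<lambda>(x, y). x \<odot>\<^bsub>T\<^esub> y)"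
    using compact_T by (simp add: compact_RG_module_def)
  from continuous_map_compose[OF continuous_map_pairedI[OF assms] this] show ?thesis
    by (simp add: o_def)
qed

lemma continuous_mact:
  assumes "continuous_map X (gtop G) c" "continuous_map X (mtop T) f"
  shows "continuous_map X (mtop T) (\<lambda>x. mact T (c x) (f x))"
proof -
  have "continuous_map (prod_topology (gtop G) (mtop T)) (mtop T) (\<lambda>(g, x). mact T g x)"
    using compact_T by (simp add: compact_RG_module_def)
  from continuous_map_compose[OF continuous_map_pairedI[OF assms] this] show ?thesis
    by (simp add: o_def)
qed

lemma continuous_closed:
  "\<lbrakk>continuous_map X (mtop T) f; x \<in> topspace X\<rbrakk> \<Longrightarrow> f x \<in> carrier T"
  using continuous_map_image_subset_topspace[of X "mtop T" f] by (auto simp: topspaces)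

lemma continuous_finsum:
  assumes "finite A" "\<And>i. i \<in> A \<Longrightarrow> continuous_map X (mtop T) (\<lambda>x. f x i)"
  shows "continuous_map X (mtop T) (\<lambda>x. \<Oplus>\<^bsub>T\<^esub>i\<in>A. f x i)"
  using assms
proof (induction A rule: finite_induct)
  case empty
  then show ?case by (simp add: topspaces)
next
  case (insert i A)
  have "continuous_map X (mtop T) (\<lambda>x. f x i \<oplus>\<^bsub>T\<^esub> (\<Oplus>\<^bsub>T\<^esub>i\<in>A. f x i))"
    using insert by (intro continuous_add) auto
  then show ?case
  proof (rule continuous_map_eq)
    fix x assume x: "x \<in> topspace X"
    have "f x j \<in> carrier T" if "j \<in> insert i A" for j
      using continuous_closed[OF insert.prems[OF that] x] .
    then show "f x i \<oplus>\<^bsub>T\<^esub> (\<Oplus>\<^bsub>T\<^esub>i\<in>A. f x i) = (\<Oplus>\<^bsub>T\<^esub>i\<in>insert i A. f x i)"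
      using insert.hyps by (simp add: T.M.finsum_insert Pi_iff)
  qed
qed

lemma continuous_matrixI:
  assumes "\<And>x. x \<in> topspace X \<Longrightarrow> f x \<in> extensional (mat_idx m n)"
    and "\<And>i j. \<lbrakk>i \<in> {1..m}; j \<in> {1..n}\<rbrakk> \<Longrightarrow> continuous_map X Y (\<lambda>x. f x (i, j))"
  shows "continuous_map X (product_topology (\<lambda>_. Y) (mat_idx m n)) f"
  using assms by (auto simp: continuous_map_componentwise mat_idx_def)

lemma continuous_matrixD:
  assumes "continuous_map X (product_topology (\<lambda>_. Y) (mat_idx m n)) f" "i \<in> {1..m}" "j \<in> {1..n}"
  shows "continuous_map X Y (\<lambda>x. f x (i, j))"
  using assms by (auto simp: continuous_map_componentwise mat_idx_def)

abbreviation mtopology :: "nat \<Rightarrow> nat \<Rightarrow> (nat \<times> nat \<Rightarrow> 't) topology" where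
  "mtopology m n \<equiv> product_topology (\<lambda>_. mtop T) (mat_idx m n)"

lemma continuous_entry:
  "\<lbrakk>i \<in> {1..m}; j \<in> {1..n}\<rbrakk> \<Longrightarrow> continuous_map (mtopology m n) (mtop T) (\<lambda>X. X (i, j))"
  using continuous_matrixD[of "mtopology m n" "mtop T" m n "\<lambda>X. X"] by simp

lemma continuous_lmult:
  assumes "continuous_map Z (product_topology (\<lambda>_. rtop R) (mat_idx m m)) P"
    and "continuous_map Z (mtopology m n) X"
  shows "continuous_map Z (mtopology m n) (\<lambda>z. mat_lmult T m n (P z) (X z))"
  by (rule continuous_matrixI)
    (use assms in \<open>auto simp: mat_apply intro!: continuous_finsum continuous_smult intro: continuous_matrixD\<close>)

lemma continuous_rmult:
  assumes "continuous_map Z (mtopology m n) X"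
    and "continuous_map Z (product_topology (\<lambda>_. rtop R) (mat_idx n n)) Q"
  shows "continuous_map Z (mtopology m n) (\<lambda>z. mat_rmult T m n (X z) (Q z))"
  by (rule continuous_matrixI)
    (use assms in \<open>auto simp: mat_apply intro!: continuous_finsum continuous_smult intro: continuous_matrixD\<close>)

lemma continuous_mat_act:
  assumes "continuous_map Z (gtop G) u" "continuous_map Z (mtopology m n) X"
  shows "continuous_map Z (mtopology m n) (\<lambda>z. mat_act T m n (u z) (X z))"
  by (rule continuous_matrixI)
    (use assms in \<open>auto simp: mat_apply intro!: continuous_mact intro: continuous_matrixD\<close>)

lemma continuous_mat_add:
  assumes "continuous_map Z (mtopology m n) X" "continuous_map Z (mtopology m n) Y"
  shows "continuous_map Z (mtopology m n) (\<lambda>z. mat_add T m n (X z) (Y z))"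
  by (rule continuous_matrixI)
    (use assms in \<open>auto simp: mat_apply intro!: continuous_add intro: continuous_matrixD\<close>)

lemma continuous_corner:
  assumes "continuous_map Z (mtop T) t"
  shows "continuous_map Z (mtopology m n) (\<lambda>z. mat_corner T m n (t z))"
proof (rule continuous_matrixI)
  fix i j assume ij: "i \<in> {1..m}" "j \<in> {1..n}"
  show "continuous_map Z (mtop T) (\<lambda>z. mat_corner T m n (t z) (i, j))"
    unfolding mat_apply(8)[OF ij] using assms by (cases "i = 1 \<and> j = n") (auto simp: topspaces)
qed auto

lemma top_gmodule_gmod_of: "top_gmodule G (gmod_of T)"
proof -
  have T: "comm_group (gmod_of T)"
    using T.M.a_comm_group by (rule comm_group_cong) (auto simp: gmod_of_def)
  have inv: "inv\<^bsub>gmod_of T\<^esub> x = \<ominus>\<^bsub>T\<^esub> x" if "x \<in> carrier T" for x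
    using that comm_group.axioms(2)[OF T]
    by (intro group.inv_equality) (auto simp: gmod_of_def T.M.l_neg)
  show ?thesis
    using T
  proof (intro top_gmodule.intro top_gmodule_axioms.intro)
    have "continuous_map (mtop T) (mtop T) (\<lambda>x. \<ominus>\<^bsub>T\<^esub> x)"
      by (intro continuous_neg) simp
    then have "continuous_map (mtop T) (mtop T) (\<lambda>x. inv\<^bsub>gmod_of T\<^esub> x)"
      by (rule continuous_map_eq) (simp add: inv topspaces)
    then show "continuous_map (gtop (gmod_of T)) (gtop (gmod_of T)) (\<lambda>x. inv\<^bsub>gmod_of T\<^esub> x)"
      by (simp add: gmod_of_def)
  qed (use profinite_G compact_T G.group_axioms in
      \<open>auto simp: gmod_of_def profinite_group_def compact_RG_module_def\<close>)
qed

end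

section \<open>Massey products\<close>

locale defining_system = rg_module G R T
  for G :: "('g, 'c) tgroup_scheme" and R :: "('r, 'd) tring_scheme" and T :: "('g, 'r, 't, 'e) rgmod_scheme" +
  fixes a b :: nat and \<phi> \<theta> :: "'g \<Rightarrow> nat \<times> nat \<Rightarrow> 'r"
  assumes system: "partial_defining_system G R a b \<phi> \<theta>"
begin

text \<open>From here on \<open>m\<close> and \<open>n\<close> are the numbers of rows and columns
  of the upper right block, so that its corner is \<open>(1, n)\<close>; this \<open>n\<close> is
  not the integer a + b.\<close>

abbreviation "m \<equiv> a + 1"
abbreviation "n \<equiv> b + 1"
abbreviation "U \<equiv> frakU R T a b \<phi> \<theta>"
abbreviation "U' \<equiv> frakU' R T a b \<phi> \<theta>"
abbreviation "N \<equiv> mat_corner T m n ` carrier T"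

lemma hom: "\<phi> \<in> hom G (unitri R m)" "\<theta> \<in> hom G (unitri R n)"
  using system by (auto simp: partial_defining_system_def)

lemma unitri_closed [simp]:
  "g \<in> carrier G \<Longrightarrow> \<phi> g \<in> carrier (unitri R m)" "g \<in> carrier G \<Longrightarrow> \<theta> g \<in> carrier (unitri R n)"
  using hom by (auto simp: hom_def)

lemma matrix_closed [simp]:
  "g \<in> carrier G \<Longrightarrow> \<phi> g \<in> matrices R m m" "g \<in> carrier G \<Longrightarrow> \<theta> g \<in> matrices R n n"
  by (simp_all add: unitri_matrix)

lemma mult_hom:
  "\<lbrakk>g \<in> carrier G; h \<in> carrier G\<rbrakk> \<Longrightarrow> rmat_mult R m (\<phi> g) (\<phi> h) = \<phi> (g \<otimes>\<^bsub>G\<^esub> h)"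
  "\<lbrakk>g \<in> carrier G; h \<in> carrier G\<rbrakk> \<Longrightarrow> rmat_mult R n (\<theta> g) (\<theta> h) = \<theta> (g \<otimes>\<^bsub>G\<^esub> h)"
  using hom_mult[OF hom(1)] hom_mult[OF hom(2)] by auto

lemma one_hom: "\<phi> \<one>\<^bsub>G\<^esub> = rmat_one R m" "\<theta> \<one>\<^bsub>G\<^esub> = rmat_one R n"
  using unitri_hom_one[OF T.R.is_cring G.group_axioms] hom by blast+

lemma continuous_system:
  "continuous_map (gtop G) (gtop (unitri R m)) \<phi>"
  "continuous_map (gtop G) (gtop (unitri R n)) \<theta>"
  "continuous_map (gtop G) (product_topology (\<lambda>_. rtop R) (mat_idx m m)) \<phi>"
  "continuous_map (gtop G) (product_topology (\<lambda>_. rtop R) (mat_idx n n)) \<theta>"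
  using system
  by (auto simp: partial_defining_system_def unitri_def Let_def continuous_map_in_subtopology)

lemma frakU_simps [simp]:
  "carrier U = matrices T m n" "mult U = mat_add T m n" "one U = mat_zero T m n"
  "gtop U = mtopology m n"
  by (auto simp: frakU_def)

text \<open>Writing the inverse matrix as \<open>\<theta> (inv g)\<close> reduces continuity and
  multiplicativity of the twist to those of \<open>\<theta>\<close> and of inversion in
  \<open>G\<close>.\<close>

lemma act_frakU:
  "g \<in> carrier G \<Longrightarrow> act U g X =
     mat_rmult T m n (mat_lmult T m n (\<phi> g) (mat_act T m n g X)) (\<theta> (inv\<^bsub>G\<^esub> g))"
  using unitri_hom_inv[OF T.R.is_cring G.group_axioms hom(2)] by (simp add: frakU_def)

lemmas mat_closed [simp] = T.mat_lmult_closed T.mat_rmult_closed T.mat_add_closed mat_act_closed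
  T.mat_corner_closed T.mat_zero_closed

lemma comm_group_frakU: "comm_group U"
  using T.comm_group_matrices by (rule comm_group_cong) auto

text \<open>The rewrites phrase the group laws through \<open>mat_add\<close> and
  \<open>mat_zero\<close>, the forms to which \<open>frakU_simps\<close> simplifies.\<close>

sublocale U: comm_group U
  rewrites "carrier U = matrices T m n" and "mult U = mat_add T m n" and "one U = mat_zero T m n"
  by (rule comm_group_frakU) auto

lemma inv_frakU: "X \<in> matrices T m n \<Longrightarrow> inv\<^bsub>U\<^esub> X = (\<lambda>q\<in>mat_idx m n. \<ominus>\<^bsub>T\<^esub> X q)"
  by (rule U.inv_equality) (auto simp: T.mat_add_neg)

lemma act_frakU_mult:
  assumes "g \<in> carrier G" "X \<in> matrices T m n" "Y \<in> matrices T m n"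
  shows "act U g (mat_add T m n X Y) = mat_add T m n (act U g X) (act U g Y)"
  using assms by (simp add: act_frakU mat_act_add T.mat_lmult_add T.mat_rmult_add)

lemma act_frakU_corner:
  "\<lbrakk>g \<in> carrier G; t \<in> carrier T\<rbrakk> \<Longrightarrow> act U g (mat_corner T m n t) = mat_corner T m n (mact T g t)"
  by (simp add: act_frakU mat_act_corner mat_lmult_corner mat_rmult_corner)

lemma act_frakU_closed: "\<lbrakk>g \<in> carrier G; X \<in> matrices T m n\<rbrakk> \<Longrightarrow> act U g X \<in> matrices T m n"
  by (simp add: act_frakU)

text \<open>Since left and right multiplications commute, the factors collect to \<phi>(g)\<phi>(h)
  on the left and \<theta>(inv h)\<theta>(inv g) on the right, and the latter is \<theta>(inv
  (gh)).\<close>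

lemma act_frakU_act:
  assumes "g \<in> carrier G" "h \<in> carrier G" "X \<in> matrices T m n"
  shows "act U (g \<otimes>\<^bsub>G\<^esub> h) X = act U g (act U h X)"
proof -
  have "act U g (act U h X) = mat_rmult T m n (mat_rmult T m n
      (mat_lmult T m n (\<phi> g) (mat_lmult T m n (\<phi> h) (mat_act T m n (g \<otimes>\<^bsub>G\<^esub> h) X)))
        (\<theta> (inv\<^bsub>G\<^esub> h))) (\<theta> (inv\<^bsub>G\<^esub> g))"
    using assms by (simp add: act_frakU mat_act_act mat_act_lmult mat_act_rmult T.mat_lmult_rmult)
  also have "\<dots> = act U (g \<otimes>\<^bsub>G\<^esub> h) X"
    using assms
    by (simp add: act_frakU T.mat_lmult_lmult T.mat_rmult_rmult mult_hom G.inv_mult_group)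
  finally show ?thesis ..
qed

lemma top_gmodule_frakU: "top_gmodule G U"
proof (intro top_gmodule.intro top_gmodule_axioms.intro)
  show "topspace (gtop U) = carrier U"
    by (simp add: topspace_product_topology topspaces)
  show "continuous_map (prod_topology (gtop U) (gtop U)) (gtop U) (\<lambda>(X, Y). X \<otimes>\<^bsub>U\<^esub> Y)"
    by (simp add: case_prod_unfold continuous_mat_add continuous_map_fst continuous_map_snd)
  have "continuous_map (mtopology m n) (mtopology m n) (\<lambda>X. \<lambda>q\<in>mat_idx m n. \<ominus>\<^bsub>T\<^esub> X q)"
    \<comment> \<open>Only membership in \<open>mat_idx\<close> is unfolded; the index set inside
      the topology stays folded, so that \<open>continuous_entry\<close> still matches.\<close>
    by (rule continuous_matrixI) (auto simp: mat_idx_def[THEN eqset_imp_iff] intro!: continuous_neg continuous_entry)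
  then show "continuous_map (gtop U) (gtop U) (\<lambda>X. inv\<^bsub>U\<^esub> X)"
    unfolding frakU_simps by (rule continuous_map_eq) (simp add: inv_frakU topspaces)
  let ?Z = "prod_topology (gtop G) (mtopology m n)"
  have inv: "continuous_map (gtop G) (gtop G) (\<lambda>g. inv\<^bsub>G\<^esub> g)"
    using profinite_G by (simp add: profinite_group_def)
  have \<phi>: "continuous_map ?Z (product_topology (\<lambda>_. rtop R) (mat_idx m m)) (\<lambda>z. \<phi> (fst z))"
    using continuous_map_compose[OF continuous_map_fst continuous_system(3)] by (simp add: o_def)
  have \<theta>: "continuous_map ?Z (product_topology (\<lambda>_. rtop R) (mat_idx n n)) (\<lambda>z. \<theta> (inv\<^bsub>G\<^esub> (fst z)))"
    using continuous_map_compose[OF continuous_map_fst continuous_map_compose[OF inv continuous_system(4)]]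
    by (simp add: o_def)
  have "continuous_map ?Z (mtopology m n) (\<lambda>z. mat_rmult T m n
      (mat_lmult T m n (\<phi> (fst z)) (mat_act T m n (fst z) (snd z))) (\<theta> (inv\<^bsub>G\<^esub> (fst z))))"
    by (intro continuous_rmult continuous_lmult continuous_mat_act \<phi> \<theta> continuous_map_fst continuous_map_snd)
  then show "continuous_map (prod_topology (gtop G) (gtop U)) (gtop U) (\<lambda>(g, X). act U g X)"
    unfolding frakU_simps by (rule continuous_map_eq) (auto simp: act_frakU topspaces)
  show "act U \<one>\<^bsub>G\<^esub> X = X" if "X \<in> carrier U" for X
    using that by (simp add: act_frakU one_hom mat_act_one T.mat_lmult_one T.mat_rmult_one)
qed (use profinite_G act_frakU_act act_frakU_mult comm_group_frakU G.group_axioms in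
    \<open>auto simp: profinite_group_def\<close>)

lemma corner_hom: "mat_corner T m n \<in> hom (gmod_of T) U"
  by (auto simp: hom_def gmod_of_def T.mat_corner_add)

lemma subgroup_N: "subgroup N U"
proof -
  interpret A: top_gmodule G "gmod_of T" by (rule top_gmodule_gmod_of)
  interpret corner: group_hom "gmod_of T" U "mat_corner T m n"
    by (intro group_hom.intro group_hom_axioms.intro corner_hom A.M.group_axioms)
      (use comm_group_frakU comm_group.axioms in blast)
  show ?thesis
    using corner.img_is_subgroup by (simp add: gmod_of_def)
qed

sublocale N: normal N U
  using comm_group.normal_iff_subgroup[OF comm_group_frakU] subgroup_N by simp

lemma frakU'_eq: "U' = quot_gmod U N"
  by (simp add: frakU'_def frakU_incl_def)

lemma proj_eq: "frakU_proj R T a b \<phi> \<theta> X = N #>\<^bsub>U\<^esub> X"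
  by (simp add: frakU_proj_def frakU_incl_def)

lemma coset_eq: "N #>\<^bsub>U\<^esub> X = (\<lambda>t. mat_add T m n (mat_corner T m n t) X) ` carrier T"
  by (auto simp: r_coset_def)

lemma quot_entry_coset:
  assumes "X \<in> matrices T m n" "i \<in> {1..m}" "j \<in> {1..n}" "(i, j) \<noteq> (1, n)"
  shows "quot_entry (N #>\<^bsub>U\<^esub> X) i j = X (i, j)"
proof -
  have "(\<lambda>Y. Y (i, j)) ` (N #>\<^bsub>U\<^esub> X) = (\<lambda>t. X (i, j)) ` carrier T"
    unfolding coset_eq image_image
    by (rule image_cong) (use assms in \<open>auto simp: mat_apply matrix_entry\<close>)
  moreover have "carrier T \<noteq> {}"
    using T.M.zero_closed by blast
  ultimately show ?thesis
    by (simp add: quot_entry_def image_constant_conv)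
qed

text \<open>Actions on quotients are elementwise images, so surjectivity of \<open>u\<close> is what
  makes the image a full coset. It is applied to the twisted action, to the entrywise action and to
  right multiplication by \<open>\<theta> g\<close>; in the last case \<open>u\<close> is the
  identity.\<close>

lemma image_coset:
  assumes f: "\<And>X Y. \<lbrakk>X \<in> matrices T m n; Y \<in> matrices T m n\<rbrakk> \<Longrightarrow>
        f (mat_add T m n X Y) = mat_add T m n (f X) (f Y)"
    and u: "u ` carrier T = carrier T" "\<And>t. t \<in> carrier T \<Longrightarrow> f (mat_corner T m n t) = mat_corner T m n (u t)"
    and X: "X \<in> matrices T m n"
  shows "f ` (N #>\<^bsub>U\<^esub> X) = N #>\<^bsub>U\<^esub> f X"
proof -
  have "f ` (N #>\<^bsub>U\<^esub> X) = (\<lambda>t. mat_add T m n (mat_corner T m n (u t)) (f X)) ` carrier T"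
    unfolding coset_eq image_image by (rule image_cong) (use X in \<open>auto simp: f u\<close>)
  also have "\<dots> = (\<lambda>t. mat_add T m n (mat_corner T m n t) (f X)) ` u ` carrier T"
    by (simp add: image_image)
  finally show ?thesis
    by (simp add: u coset_eq)
qed

lemma mact_surj: "g \<in> carrier G \<Longrightarrow> mact T g ` carrier T = carrier T"
proof (intro equalityI subsetI)
  fix t assume "g \<in> carrier G" "t \<in> carrier T"
  then have "t = mact T g (mact T (inv\<^bsub>G\<^esub> g) t)" "mact T (inv\<^bsub>G\<^esub> g) t \<in> carrier T"
    by (auto simp: mact_one simp flip: mact_mact)
  then show "t \<in> mact T g ` carrier T" by blast
qed auto

lemma act_coset:
  "\<lbrakk>g \<in> carrier G; X \<in> matrices T m n\<rbrakk> \<Longrightarrow> act U g ` (N #>\<^bsub>U\<^esub> X) = N #>\<^bsub>U\<^esub> act U g X"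
  by (rule image_coset[where u = "mact T g"]) (auto simp: act_frakU_mult act_frakU_corner mact_surj)

lemma mat_act_coset:
  "\<lbrakk>g \<in> carrier G; X \<in> matrices T m n\<rbrakk> \<Longrightarrow> mat_act T m n g ` (N #>\<^bsub>U\<^esub> X) = N #>\<^bsub>U\<^esub> mat_act T m n g X"
  by (rule image_coset[where u = "mact T g"]) (auto simp: mat_act_add mat_act_corner mact_surj)

lemma rmult_coset:
  "\<lbrakk>g \<in> carrier G; X \<in> matrices T m n\<rbrakk> \<Longrightarrow>
    (\<lambda>X. mat_rmult T m n X (\<theta> g)) ` (N #>\<^bsub>U\<^esub> X) = N #>\<^bsub>U\<^esub> mat_rmult T m n X (\<theta> g)"
  by (rule image_coset[where u = "\<lambda>t. t"]) (auto simp: T.mat_rmult_add mat_rmult_corner)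

end

section \<open>The normalised lift of the cocycle and its coboundary\<close>

locale massey_system = defining_system G R T a b \<phi> \<theta>
  for G :: "('g, 'c) tgroup_scheme" and R :: "('r, 'd) tring_scheme" and T :: "('g, 'r, 't, 'e) rgmod_scheme"
    and a b \<phi> \<theta> +
  fixes \<kappa>' :: "'g \<Rightarrow> (nat \<times> nat \<Rightarrow> 't) set" and \<rho> :: "'g \<Rightarrow> ('r, 't) block set"
  assumes cocycle: "\<kappa>' \<in> carrier (Z1 G U')"
    and \<rho>: "g \<in> carrier G \<Longrightarrow> \<rho> g = block' (\<phi> g) ((\<lambda>X. mat_rmult T m n X (\<theta> g)) ` \<kappa>' g) (\<theta> g)"
begin

lemma C1_cocycle: "\<kappa>' \<in> C1 G U'"
  using cocycle by (simp add: Z1_def)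

text \<open>\<open>\<kappa>0\<close> is the lift of \<open>\<kappa>'\<close> with upper right entry zero; \<open>\<kappa>\<close> is the lift for which the upper right
  entry of \<open>\<kappa> \<theta>\<close>, instead of that of \<open>\<kappa>\<close>, vanishes, so that \<open>X = \<kappa> \<theta>\<close> is the block of the lift of \<open>\<rho>\<close>.\<close>

definition \<kappa>0 :: "'g \<Rightarrow> nat \<times> nat \<Rightarrow> 't" where
  "\<kappa>0 g = (\<lambda>q\<in>mat_idx m n. if q = (1, n) then \<zero>\<^bsub>T\<^esub> else quot_entry (\<kappa>' g) (fst q) (snd q))"

definition \<kappa> :: "'g \<Rightarrow> nat \<times> nat \<Rightarrow> 't" where
  "\<kappa> g = mat_add T m n (mat_corner T m n (\<ominus>\<^bsub>T\<^esub> mat_rmult T m n (\<kappa>0 g) (\<theta> g) (1, n))) (\<kappa>0 g)"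

definition X :: "'g \<Rightarrow> nat \<times> nat \<Rightarrow> 't" where
  "X g = mat_rmult T m n (\<kappa> g) (\<theta> g)"

lemma \<kappa>'_coset:
  assumes "g \<in> carrier G"
  obtains Y where "Y \<in> matrices T m n" "\<kappa>' g = N #>\<^bsub>U\<^esub> Y"
proof -
  have "\<kappa>' g \<in> carrier U'"
    using C1_cocycle assms by (auto simp: C1_def)
  then show thesis
    using that by (auto simp: frakU'_eq carrier_quot_gmod)
qed

lemma \<kappa>0_closed [simp]: "g \<in> carrier G \<Longrightarrow> \<kappa>0 g \<in> matrices T m n"
  and coset_\<kappa>0: "g \<in> carrier G \<Longrightarrow> N #>\<^bsub>U\<^esub> \<kappa>0 g = \<kappa>' g"
proof -
  assume g: "g \<in> carrier G"
  obtain Y where Y: "Y \<in> matrices T m n" and eq: "\<kappa>' g = N #>\<^bsub>U\<^esub> Y"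
    using \<kappa>'_coset[OF g] .
  have entry: "\<kappa>0 g (i, j) = (if (i, j) = (1, n) then \<zero>\<^bsub>T\<^esub> else Y (i, j))"
    if "i \<in> {1..m}" "j \<in> {1..n}" for i j
    using that quot_entry_coset[OF Y that] by (simp add: \<kappa>0_def eq mat_idx_def)
  have ext: "\<kappa>0 g \<in> extensional (mat_idx m n)"
    by (simp add: \<kappa>0_def)
  show closed: "\<kappa>0 g \<in> matrices T m n"
    by (rule matricesI[OF ext]) (simp add: entry matrix_entry[OF Y])
  have Y1: "Y (1, n) \<in> carrier T"
    using matrix_entry[OF Y, of 1 n] by simp
  have "Y = mat_add T m n (mat_corner T m n (Y (1, n))) (\<kappa>0 g)"
    by (rule matrix_eqI[of _ m n])
      (use Y Y1 in \<open>auto simp: mat_apply entry matrix_entry matrices_extensional\<close>)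
  then have "Y \<in> N #>\<^bsub>U\<^esub> \<kappa>0 g"
    using Y1 unfolding coset_eq by blast
  then show "N #>\<^bsub>U\<^esub> \<kappa>0 g = \<kappa>' g"
    using U.repr_independence[OF _ closed] subgroup_N unfolding eq by blast
qed

lemma corner_\<kappa>0_closed [simp]:
  "g \<in> carrier G \<Longrightarrow> mat_rmult T m n (\<kappa>0 g) (\<theta> g) (1, n) \<in> carrier T"
  by (rule matrix_entry[of _ m n T]) auto

lemma \<kappa>_closed [simp]: "g \<in> carrier G \<Longrightarrow> \<kappa> g \<in> matrices T m n"
  by (simp add: \<kappa>_def)

lemma X_closed [simp]: "g \<in> carrier G \<Longrightarrow> X g \<in> matrices T m n"
  by (simp add: X_def)

lemma coset_\<kappa>: "g \<in> carrier G \<Longrightarrow> N #>\<^bsub>U\<^esub> \<kappa> g = \<kappa>' g"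
proof -
  assume g: "g \<in> carrier G"
  then have "\<kappa> g \<in> N #>\<^bsub>U\<^esub> \<kappa>0 g"
    unfolding coset_eq \<kappa>_def by (intro imageI T.M.a_inv_closed corner_\<kappa>0_closed)
  then show ?thesis
    using U.repr_independence[OF _ \<kappa>0_closed[OF g]] subgroup_N coset_\<kappa>0[OF g] by blast
qed

text \<open>Right multiplication by \<open>\<theta> g\<close> fixes corner matrices, so the
  correction in \<open>\<kappa>\<close> reaches \<open>X\<close> unchanged and cancels the corner
  contributed by \<open>\<kappa>0\<close>.\<close>

lemma X_corner: "g \<in> carrier G \<Longrightarrow> X g (1, n) = \<zero>\<^bsub>T\<^esub>"
  by (simp add: X_def \<kappa>_def T.mat_rmult_add mat_rmult_corner mat_apply(5,8) T.M.l_neg)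

text \<open>The first column of \<open>\<theta> g\<close> is the first unit vector. For i = a + 1
  this identifies the middle argument of the Massey product with an entry of
  \<open>\<kappa>'\<close>.\<close>

lemma X_first_column: "g \<in> carrier G \<Longrightarrow> i \<in> {1..m} \<Longrightarrow> X g (i, 1) = \<kappa> g (i, 1)"
proof -
  assume g: "g \<in> carrier G" and i: "i \<in> {1..m}"
  have "X g (i, 1) = \<theta> g (1, 1) \<odot>\<^bsub>T\<^esub> \<kappa> g (i, 1)"
    unfolding X_def mat_apply(4)[OF i, of 1 n, simplified]
    by (rule T.M.finsum_eq_single)
      (use g i unitri_lower[OF unitri_closed(2)[OF g], of _ 1] in
        \<open>auto simp: matrix_entry[of _ m n T] unitri_entry[OF unitri_closed(2)[OF g]]\<close>)
  then show ?thesis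
    using unitri_diag[OF unitri_closed(2)[OF g], of 1] matrix_entry[of "\<kappa> g" m n T i 1] g i by simp
qed

lemma \<rho>_eq: "g \<in> carrier G \<Longrightarrow> \<rho> g = block' (\<phi> g) (N #>\<^bsub>U\<^esub> X g) (\<theta> g)"
  using rmult_coset[of g "\<kappa> g"] by (simp add: \<rho> X_def coset_\<kappa>)

text \<open>Elements of a coset differ by corner matrices, so a zero corner entry singles out one of
  them.\<close>

lemma lift_\<rho>: "g \<in> carrier G \<Longrightarrow> calU_lift T b (\<rho> g) = (\<phi> g, X g, \<theta> g)"
proof -
  assume g: "g \<in> carrier G"
  have mem: "X g \<in> N #>\<^bsub>U\<^esub> X g"
    using U.rcos_self[of "X g" N] subgroup_N g by simp
  have "Y = X g" if Y: "Y \<in> N #>\<^bsub>U\<^esub> X g" "Y (1, n) = \<zero>\<^bsub>T\<^esub>" for Y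
  proof -
    obtain t where t: "t \<in> carrier T" "Y = mat_add T m n (mat_corner T m n t) (X g)"
      using Y(1) unfolding coset_eq by blast
    have "t = \<zero>\<^bsub>T\<^esub>"
      using Y(2) t X_corner[OF g] by (simp add: mat_apply(5,8))
    then have "mat_corner T m n t = mat_zero T m n"
      by (auto simp: mat_corner_def mat_zero_def)
    then show ?thesis
      using t(2) U.l_one[of "X g"] g by simp
  qed
  then show ?thesis
    unfolding calU_lift_def \<rho>_eq[OF g] block'_def
    by (intro the_equality) (use mem X_corner[OF g] in auto)
qed

text \<open>The section of the projection is explicit: entries off the corner factor continuously
  through the quotient, and the corner of \<open>\<kappa>\<close> is a continuous expression in
  those entries and \<open>\<theta>\<close>.\<close>

lemma continuous_\<kappa>: "continuous_map (gtop G) (mtopology m n) \<kappa>"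
proof -
  have U: "topspace (gtop U) = carrier U"
    by (simp add: topspaces)
  have "continuous_map (gtop G) (gtop (quot_gmod U N)) \<kappa>'"
    using C1_cocycle by (simp add: C1_def frakU'_eq)
  then have entry: "continuous_map (gtop G) (mtop T) (\<lambda>g. quot_entry (\<kappa>' g) i j)"
    if "i \<in> {1..m}" "j \<in> {1..n}" "(i, j) \<noteq> (1, n)" for i j
    using continuous_map_compose[OF _ continuous_from_quot_gmod[OF U, of "mtop T" "\<lambda>X. X (i, j)" "\<lambda>C. quot_entry C i j" N]]
      quot_entry_coset[OF _ that] continuous_entry[OF that(1,2)] by (simp add: o_def)
  have \<kappa>0: "continuous_map (gtop G) (mtopology m n) \<kappa>0"
  proof (rule continuous_matrixI)
    fix i j assume ij: "i \<in> {1..m}" "j \<in> {1..n}"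
    show "continuous_map (gtop G) (mtop T) (\<lambda>g. \<kappa>0 g (i, j))"
    proof (cases "(i, j) = (1, n)")
      case True
      then show ?thesis by (simp add: \<kappa>0_def mat_idx_def topspaces)
    next
      case False
      then show ?thesis
        using entry[OF ij False] ij by (auto simp: \<kappa>0_def mat_idx_def)
    qed
  qed (simp add: \<kappa>0_def)
  have "continuous_map (gtop G) (mtop T) (\<lambda>g. mat_rmult T m n (\<kappa>0 g) (\<theta> g) (1, n))"
    by (rule continuous_matrixD[OF continuous_rmult[OF \<kappa>0 continuous_system(4)]]) auto
  then have "continuous_map (gtop G) (mtopology m n)
      (\<lambda>g. mat_add T m n (mat_corner T m n (\<ominus>\<^bsub>T\<^esub> mat_rmult T m n (\<kappa>0 g) (\<theta> g) (1, n))) (\<kappa>0 g))"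
    by (intro continuous_mat_add continuous_corner continuous_neg \<kappa>0)
  then show ?thesis
    by (simp add: \<kappa>_def[abs_def])
qed

lemma continuous_X: "continuous_map (gtop G) (mtopology m n) X"
  using continuous_rmult[OF continuous_\<kappa> continuous_system(4)] by (simp add: X_def[abs_def])

lemma proj_hom: "group_hom U U' (\<lambda>X. N #>\<^bsub>U\<^esub> X)"
proof -
  have "comm_group U'"
    unfolding frakU'_eq by (rule comm_group_quot_gmod[OF comm_group_frakU subgroup_N])
  then have "group U'"
    by (rule comm_group.axioms(2))
  moreover have "group U"
    using comm_group_frakU by (rule comm_group.axioms(2))
  moreover have "(\<lambda>X. N #>\<^bsub>U\<^esub> X) \<in> hom U U'"
    using N.rcos_sum by (auto simp: hom_def frakU'_eq carrier_quot_gmod)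
  ultimately show ?thesis
    by (intro group_hom.intro group_hom_axioms.intro)
qed

lemma \<kappa>_C1: "(\<lambda>g\<in>carrier G. \<kappa> g) \<in> C1 G U"
  using top_gmodule.C1_restrictI[OF top_gmodule_frakU] continuous_\<kappa> by simp

text \<open>At this stage \<open>s\<close> is just the corner of the coboundary; comparing corner
  entries in the last identity later shows that it is the value of the Massey cocycle. The full
  matrix identity is kept because \<open>proper\<close> needs all entries.\<close>

lemma d1_\<kappa>:
  assumes g: "g \<in> carrier G" and h: "h \<in> carrier G"
  obtains s where "s \<in> carrier T" "d1 G U (\<lambda>g\<in>carrier G. \<kappa> g) (g, h) = mat_corner T m n s"
    "mat_add T m n (mat_lmult T m n (\<phi> g) (mat_act T m n g (X h))) (mat_rmult T m n (X g) (\<theta> h)) =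
      mat_add T m n (mat_corner T m n s) (X (g \<otimes>\<^bsub>G\<^esub> h))"
proof -
  interpret p: group_hom U U' "\<lambda>X. N #>\<^bsub>U\<^esub> X"
    by (rule proj_hom)
  let ?gh = "g \<otimes>\<^bsub>G\<^esub> h"
  let ?D = "d1 G U (\<lambda>g\<in>carrier G. \<kappa> g) (g, h)"
  have gh: "?gh \<in> carrier G"
    using g h by simp
  have D: "?D = mat_add T m n (mat_add T m n (act U g (\<kappa> h)) (inv\<^bsub>U\<^esub> \<kappa> ?gh)) (\<kappa> g)"
    using g h by (simp add: d1_def)
  have act: "act U g (\<kappa> h) \<in> matrices T m n"
    using g h by (simp add: act_frakU_closed)
  have inv: "inv\<^bsub>U\<^esub> \<kappa> ?gh \<in> matrices T m n"
    using U.inv_closed[of "\<kappa> ?gh"] gh by simp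
  have D_closed: "?D \<in> matrices T m n"
    unfolding D using g act inv by simp
  have "N #>\<^bsub>U\<^esub> ?D = d1 G U' \<kappa>' (g, h)"
  proof -
    have "N #>\<^bsub>U\<^esub> ?D = (N #>\<^bsub>U\<^esub> act U g (\<kappa> h)) \<otimes>\<^bsub>U'\<^esub> (N #>\<^bsub>U\<^esub> (inv\<^bsub>U\<^esub> \<kappa> ?gh)) \<otimes>\<^bsub>U'\<^esub> (N #>\<^bsub>U\<^esub> \<kappa> g)"
      unfolding D using act inv g p.hom_mult by simp
    also have "N #>\<^bsub>U\<^esub> (inv\<^bsub>U\<^esub> \<kappa> ?gh) = inv\<^bsub>U'\<^esub> \<kappa>' ?gh"
      using p.hom_inv[of "\<kappa> ?gh"] gh coset_\<kappa>[OF gh] by simp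
    also have "N #>\<^bsub>U\<^esub> act U g (\<kappa> h) = act U' g (\<kappa>' h)"
      using act_coset[OF g \<kappa>_closed[OF h]] coset_\<kappa>[OF h] by (simp add: frakU'_eq)
    finally show ?thesis
      using g h coset_\<kappa>[OF g] by (simp add: d1_def)
  qed
  also have "\<dots> = N"
    using cocycle g h by (auto simp: Z1_def frakU'_eq)
  finally have "?D \<in> N"
    using U.coset_join1[of N ?D] D_closed subgroup_N by simp
  then obtain s where s: "s \<in> carrier T" and Ds: "?D = mat_corner T m n s"
    by blast
  \<comment> \<open>The inverse is moved to the other side first, so that right multiplication by
    \<open>\<theta> ?gh\<close> only meets sums.\<close>
  have "mat_add T m n (act U g (\<kappa> h)) (\<kappa> g) = mat_add T m n ?D (\<kappa> ?gh)"
  proof -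
    have "mat_add T m n ?D (\<kappa> ?gh) =
        mat_add T m n (mat_add T m n (act U g (\<kappa> h)) (\<kappa> g)) (mat_add T m n (inv\<^bsub>U\<^esub> \<kappa> ?gh) (\<kappa> ?gh))"
      unfolding D by (simp only: U.m_ac U.m_closed act inv \<kappa>_closed[OF g] \<kappa>_closed[OF gh])
    then show ?thesis
      using act g gh by simp
  qed
  then have "mat_rmult T m n (mat_add T m n (act U g (\<kappa> h)) (\<kappa> g)) (\<theta> ?gh) =
      mat_rmult T m n (mat_add T m n (mat_corner T m n s) (\<kappa> ?gh)) (\<theta> ?gh)"
    by (simp add: Ds)
  \<comment> \<open>The twist contributes \<theta>(inv g), and \<theta>(inv g)\<theta>(gh) =
    \<theta>(h); this factor turns \<open>\<kappa> h\<close> into \<open>X h\<close>, because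
    \<open>G\<close> acts only on the entries from \<open>T\<close>.\<close>
  moreover have "mat_rmult T m n (act U g (\<kappa> h)) (\<theta> ?gh) = mat_lmult T m n (\<phi> g) (mat_act T m n g (X h))"
  proof -
    have "inv\<^bsub>G\<^esub> g \<otimes>\<^bsub>G\<^esub> ?gh = h"
      using g h by (simp add: G.l_inv_cancel)
    then show ?thesis
      using g h gh
      by (simp add: act_frakU T.mat_rmult_rmult mult_hom X_def mat_act_rmult T.mat_lmult_rmult)
  qed
  moreover have "mat_rmult T m n (\<kappa> g) (\<theta> ?gh) = mat_rmult T m n (X g) (\<theta> h)"
    using g h by (simp add: X_def T.mat_rmult_rmult mult_hom)
  ultimately have "mat_add T m n (mat_lmult T m n (\<phi> g) (mat_act T m n g (X h))) (mat_rmult T m n (X g) (\<theta> h)) =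
      mat_add T m n (mat_corner T m n s) (X ?gh)"
    using act g gh s by (simp add: T.mat_rmult_add mat_rmult_corner) (simp add: X_def)
  with s Ds show ?thesis
    using that by blast
qed

text \<open>The full matrix product has two terms more than the Massey sum: l = 1 on the left,
  containing the corner of \<open>X h\<close>, and l = b + 1 on the right, containing the corner of
  \<open>X g\<close>. Both corners are zero.\<close>

lemma massey_corner:
  assumes g: "g \<in> carrier G" and h: "h \<in> carrier G"
  shows "massey_cocycle G T a b \<rho> (g, h) =
    mat_add T m n (mat_lmult T m n (\<phi> g) (mat_act T m n g (X h))) (mat_rmult T m n (X g) (\<theta> h)) (1, n)"
proof -
  have corner: "1 \<in> {1..m}" "n \<in> {1..n}"
    by auto
  have P: "\<phi> g (1, l) \<in> carrier R" if "l \<in> {1..m}" for l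
    using unitri_entry[OF unitri_closed(1)[OF g], of 1 l] that by simp
  have Q: "\<theta> h (l, n) \<in> carrier R" if "l \<in> {1..n}" for l
    using unitri_entry[OF unitri_closed(2)[OF h], of l n] that by simp
  have Xh: "X h (l, n) \<in> carrier T" if "l \<in> {1..m}" for l
    using matrix_entry[OF X_closed[OF h] that, of n] by simp
  have Xg: "X g (1, l) \<in> carrier T" if "l \<in> {1..n}" for l
    using matrix_entry[OF X_closed[OF g], of 1 l] that by simp
  have "{1..m} = insert 1 {2..m}" by auto
  then have 1: "(\<Oplus>\<^bsub>T\<^esub>l\<in>{1..m}. \<phi> g (1, l) \<odot>\<^bsub>T\<^esub> mact T g (X h (l, n))) =
      (\<Oplus>\<^bsub>T\<^esub>l\<in>{2..m}. \<phi> g (1, l) \<odot>\<^bsub>T\<^esub> mact T g (X h (l, n)))"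
    using P Xh g X_corner[OF h] by (simp add: T.M.finsum_insert Pi_iff)
  have "{1..n} = insert n {1..b}" by auto
  then have 2: "(\<Oplus>\<^bsub>T\<^esub>l\<in>{1..n}. \<theta> h (l, n) \<odot>\<^bsub>T\<^esub> X g (1, l)) =
      (\<Oplus>\<^bsub>T\<^esub>l\<in>{1..b}. \<theta> h (l, n) \<odot>\<^bsub>T\<^esub> X g (1, l))"
    using Q Xg X_corner[OF g] by (simp add: T.M.finsum_insert Pi_iff)
  have "mat_lmult T m n (\<phi> g) (mat_act T m n g (X h)) (1, n) =
      (\<Oplus>\<^bsub>T\<^esub>l\<in>{1..m}. \<phi> g (1, l) \<odot>\<^bsub>T\<^esub> mact T g (X h (l, n)))"
    unfolding mat_apply(3)[OF corner]
    by (rule T.M.finsum_cong') (use P Xh g in \<open>auto simp: mat_apply(7)\<close>)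
  moreover have "mat_rmult T m n (X g) (\<theta> h) (1, n) = (\<Oplus>\<^bsub>T\<^esub>l\<in>{1..n}. \<theta> h (l, n) \<odot>\<^bsub>T\<^esub> X g (1, l))"
    by (rule mat_apply(4)[OF corner])
  ultimately show ?thesis
    using g h by (simp add: massey_cocycle_def lift_\<rho> 1 2 mat_apply(5))
qed

lemma massey_cocycle_eq:
  assumes "g \<in> carrier G" "h \<in> carrier G"
  shows "massey_cocycle G T a b \<rho> (g, h) \<in> carrier T"
    and "mat_corner T m n (massey_cocycle G T a b \<rho> (g, h)) = d1 G U (\<lambda>g\<in>carrier G. \<kappa> g) (g, h)"
    and "mat_add T m n (mat_lmult T m n (\<phi> g) (mat_act T m n g (X h))) (mat_rmult T m n (X g) (\<theta> h)) =
      mat_add T m n (mat_corner T m n (massey_cocycle G T a b \<rho> (g, h))) (X (g \<otimes>\<^bsub>G\<^esub> h))"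
proof -
  obtain s where s: "s \<in> carrier T" "d1 G U (\<lambda>g\<in>carrier G. \<kappa> g) (g, h) = mat_corner T m n s"
    "mat_add T m n (mat_lmult T m n (\<phi> g) (mat_act T m n g (X h))) (mat_rmult T m n (X g) (\<theta> h)) =
      mat_add T m n (mat_corner T m n s) (X (g \<otimes>\<^bsub>G\<^esub> h))"
    using d1_\<kappa>[OF assms] .
  have "massey_cocycle G T a b \<rho> (g, h) = s"
    unfolding massey_corner[OF assms] s(3)
    using s(1) X_corner[of "g \<otimes>\<^bsub>G\<^esub> h"] assms by (simp add: mat_apply(5,8))
  with s show "massey_cocycle G T a b \<rho> (g, h) \<in> carrier T"
    "mat_corner T m n (massey_cocycle G T a b \<rho> (g, h)) = d1 G U (\<lambda>g\<in>carrier G. \<kappa> g) (g, h)"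
    "mat_add T m n (mat_lmult T m n (\<phi> g) (mat_act T m n g (X h))) (mat_rmult T m n (X g) (\<theta> h)) =
      mat_add T m n (mat_corner T m n (massey_cocycle G T a b \<rho> (g, h))) (X (g \<otimes>\<^bsub>G\<^esub> h))"
    by auto
qed

lemma connecting_eq_massey:
  "connecting G (gmod_of T) U U' (frakU_incl T a b) (frakU_proj R T a b \<phi> \<theta>) (class1 G U' \<kappa>') =
    massey_product G T a b \<rho>"
  unfolding massey_product_def
proof (rule connecting_class1[where r = "\<lambda>Y. Y (1, n)", OF top_gmodule_gmod_of top_gmodule_frakU])
  have p: "frakU_proj R T a b \<phi> \<theta> = (\<lambda>X. N #>\<^bsub>U\<^esub> X)"
    by (auto simp: proj_eq)
  have i: "frakU_incl T a b = mat_corner T m n"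
    by (simp add: frakU_incl_def)
  show "comm_group U'"
    unfolding frakU'_eq by (rule comm_group_quot_gmod[OF comm_group_frakU subgroup_N])
  show "frakU_incl T a b \<in> hom (gmod_of T) U"
    unfolding i by (rule corner_hom)
  show "frakU_incl T a b (act (gmod_of T) g x) = act U g (frakU_incl T a b x)"
    if "g \<in> carrier G" "x \<in> carrier (gmod_of T)" for g x
    using that by (simp add: i gmod_of_def act_frakU_corner)
  show "continuous_map (gtop U) (gtop (gmod_of T)) (\<lambda>Y. Y (1, n))"
    using continuous_entry[of 1 m n n] by (simp add: gmod_of_def)
  show "frakU_incl T a b x (1, n) = x" for x
    by (simp add: i mat_apply(8))
  show "frakU_proj R T a b \<phi> \<theta> \<in> hom U U'"
    unfolding p using group_hom.homh[OF proj_hom] .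
  show "frakU_proj R T a b \<phi> \<theta> ` carrier U = carrier U'"
    by (simp add: p frakU'_eq carrier_quot_gmod)
  show "frakU_proj R T a b \<phi> \<theta> (act U g x) = act U' g (frakU_proj R T a b \<phi> \<theta> x)"
    if "g \<in> carrier G" "x \<in> carrier U" for g x
    using that act_coset by (simp add: p frakU'_eq)
  show "x \<in> frakU_incl T a b ` carrier (gmod_of T)"
    if "x \<in> carrier U" "frakU_proj R T a b \<phi> \<theta> x = \<one>\<^bsub>U'\<^esub>" for x
    using that U.coset_join1[of N x] subgroup_N by (simp add: p i frakU'_eq gmod_of_def)
  show "\<kappa>' \<in> extensional (carrier G)"
    using C1_cocycle by (auto simp: C1_def PiE_def)
  show "(\<lambda>g\<in>carrier G. \<kappa> g) \<in> C1 G U"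
    by (rule \<kappa>_C1)
  show "frakU_proj R T a b \<phi> \<theta> ((\<lambda>g\<in>carrier G. \<kappa> g) g) = \<kappa>' g" if "g \<in> carrier G" for g
    using that by (simp add: p coset_\<kappa>)
  show "massey_cocycle G T a b \<rho> \<in> carrier G \<times> carrier G \<rightarrow>\<^sub>E carrier (gmod_of T)"
    using massey_cocycle_eq(1) by (auto simp: gmod_of_def massey_cocycle_def)
  show "frakU_incl T a b (massey_cocycle G T a b \<rho> q) = d1 G U (\<lambda>g\<in>carrier G. \<kappa> g) q"
    if "q \<in> carrier G \<times> carrier G" for q
    using that massey_cocycle_eq(2) by (auto simp: i)
qed

section \<open>The associated proper defining system\<close>

text \<open>Matches the product-of-sets description of elements of \<open>calU'\<close> with cosets
  of the central subgroup: multiplying by a central element only adds a corner matrix to the upper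
  right block, since \<open>Q\<close> fixes corner matrices.\<close>

lemma block'_coset:
  assumes P: "P \<in> carrier (unitri R m)" and Q: "Q \<in> carrier (unitri R n)" and Y: "Y \<in> matrices T m n"
  shows "block' P (N #>\<^bsub>U\<^esub> Y) Q = calU_centre R T a b #>\<^bsub>calU R T a b\<^esub> (P, Y, Q)"
proof -
  interpret P: monoid "unitri R m" by (rule monoid_unitri) (rule T.R.is_cring)
  interpret Q: monoid "unitri R n" by (rule monoid_unitri) (rule T.R.is_cring)
  have [simp]: "rmat_mult R m (rmat_one R m) P = P" "rmat_mult R n (rmat_one R n) Q = Q"
    using P.l_one[OF P] Q.l_one[OF Q] by simp_all
  have "mat_add T m n (mat_lmult T m n (rmat_one R m) Y) (mat_rmult T m n (mat_corner T m n t) Q) =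
      mat_add T m n (mat_corner T m n t) Y" if "t \<in> carrier T" for t
    using that Q Y by (simp add: T.mat_lmult_one mat_rmult_corner U.m_comm)
  then show ?thesis
    by (auto simp: block'_def coset_eq r_coset_def calU_centre_def calU_def image_iff)
qed

text \<open>Continuity comes from the lift to \<open>calU\<close> composed with the projection.
  Multiplicativity is checked on cosets as sets, by multiplying arbitrary representatives.\<close>

lemma proper: "proper_defining_system G R T a b \<phi> \<theta> \<rho>"
  unfolding proper_defining_system_def
proof (intro conjI ballI)
  let ?C = "calU R T a b" and ?Z = "calU_centre R T a b"
  have \<rho>_coset: "\<rho> g = ?Z #>\<^bsub>?C\<^esub> (\<phi> g, X g, \<theta> g)" if "g \<in> carrier G" for g
    using that \<rho>_eq block'_coset by simp
  have mem: "(\<phi> g, X g, \<theta> g) \<in> carrier ?C" if "g \<in> carrier G" for g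
    using that by (simp add: calU_def)
  show "\<rho> \<in> carrier G \<rightarrow> carrier (calU' R T a b)"
    using \<rho>_coset mem by (auto simp: calU'_def carrier_quot_gmod)
  have "topspace (gtop (unitri R k)) = carrier (unitri R k)" for k
    by (auto simp: unitri_def Let_def topspaces)
  then have topC: "topspace (gtop ?C) = carrier ?C"
    by (simp add: calU_def topspaces)
  have "continuous_map (gtop G) (gtop ?C) (\<lambda>g. (\<phi> g, X g, \<theta> g))"
    by (simp add: calU_def continuous_map_paired continuous_system continuous_X)
  then have "continuous_map (gtop G) (gtop (calU' R T a b)) (\<lambda>g. ?Z #>\<^bsub>?C\<^esub> (\<phi> g, X g, \<theta> g))"
    unfolding calU'_def by (rule continuous_into_quot_gmod[OF topC])
  then show "continuous_map (gtop G) (gtop (calU' R T a b)) \<rho>"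
    by (rule continuous_map_eq) (simp add: \<rho>_coset topspaces)
  show "\<exists>\<kappa>\<in>carrier G \<rightarrow> carrier (frakU' R T a b \<phi> \<theta>). \<forall>g\<in>carrier G. \<rho> g = block' (\<phi> g) (\<kappa> g) (\<theta> g)"
    by (rule bexI[of _ "\<lambda>g. N #>\<^bsub>U\<^esub> X g"]) (auto simp: \<rho>_eq frakU'_eq carrier_quot_gmod)
next
  fix g h assume g: "g \<in> carrier G" and h: "h \<in> carrier G"
  let ?gh = "g \<otimes>\<^bsub>G\<^esub> h"
  let ?s = "massey_cocycle G T a b \<rho> (g, h)"
  have s: "?s \<in> carrier T"
    using massey_cocycle_eq(1)[OF g h] .
  have gh: "?gh \<in> carrier G"
    using g h by simp
  have act: "act (calU' R T a b) g (\<rho> h) = block' (\<phi> h) (N #>\<^bsub>U\<^esub> mat_act T m n g (X h)) (\<theta> h)"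
    using mat_act_coset[OF g X_closed[OF h], symmetric]
    by (force simp: calU'_def calU_def \<rho>_eq[OF h] block'_def image_iff)
  \<comment> \<open>Here \<open>t\<close> and \<open>t'\<close> are the corners of arbitrary
    representatives. They pass through the multiplications unchanged, so they only add to the Massey
    value \<open>?s\<close>, the failure of the normalised lift to be multiplicative.\<close>
  have prod: "mat_add T m n
        (mat_lmult T m n (\<phi> g) (mat_add T m n (mat_corner T m n t') (mat_act T m n g (X h))))
        (mat_rmult T m n (mat_add T m n (mat_corner T m n t) (X g)) (\<theta> h)) =
      mat_add T m n (mat_corner T m n (t' \<oplus>\<^bsub>T\<^esub> t \<oplus>\<^bsub>T\<^esub> ?s)) (X ?gh)"
    if "t \<in> carrier T" "t' \<in> carrier T" for t t'
  proof -
    have "mat_add T m n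
        (mat_lmult T m n (\<phi> g) (mat_add T m n (mat_corner T m n t') (mat_act T m n g (X h))))
        (mat_rmult T m n (mat_add T m n (mat_corner T m n t) (X g)) (\<theta> h)) =
      mat_add T m n (mat_add T m n (mat_corner T m n t') (mat_corner T m n t))
        (mat_add T m n (mat_lmult T m n (\<phi> g) (mat_act T m n g (X h))) (mat_rmult T m n (X g) (\<theta> h)))"
      using that g h
      by (simp add: T.mat_lmult_add T.mat_rmult_add mat_lmult_corner mat_rmult_corner)
        (simp add: U.m_ac)
    then show ?thesis
      unfolding massey_cocycle_eq(3)[OF g h] using that s gh
      by (simp add: T.mat_corner_add flip: U.m_assoc)
  qed
  have "\<rho> g \<otimes>\<^bsub>calU' R T a b\<^esub> act (calU' R T a b) g (\<rho> h) =
      {\<phi> ?gh} \<times> (\<Union>t\<in>carrier T. \<Union>t'\<in>carrier T.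
        {mat_add T m n (mat_corner T m n (t' \<oplus>\<^bsub>T\<^esub> t \<oplus>\<^bsub>T\<^esub> ?s)) (X ?gh)}) \<times> {\<theta> ?gh}"
    unfolding act \<rho>_eq[OF g]
    using prod mult_hom[OF g h]
    by (force simp: calU'_def set_mult_def calU_def block'_def coset_eq)
  also have "(\<Union>t\<in>carrier T. \<Union>t'\<in>carrier T.
        {mat_add T m n (mat_corner T m n (t' \<oplus>\<^bsub>T\<^esub> t \<oplus>\<^bsub>T\<^esub> ?s)) (X ?gh)}) = N #>\<^bsub>U\<^esub> X ?gh"
  proof (intro equalityI subsetI)
    fix Y assume "Y \<in> N #>\<^bsub>U\<^esub> X ?gh"
    then obtain t where t: "t \<in> carrier T" "Y = mat_add T m n (mat_corner T m n t) (X ?gh)"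
      unfolding coset_eq by blast
    \<comment> \<open>To reach every corner \<open>t\<close>, the first representative absorbs the
      defect \<open>?s\<close> and the second is taken with correction zero.\<close>
    have "t = \<zero>\<^bsub>T\<^esub> \<oplus>\<^bsub>T\<^esub> (t \<oplus>\<^bsub>T\<^esub> \<ominus>\<^bsub>T\<^esub> ?s) \<oplus>\<^bsub>T\<^esub> ?s"
      using t s by (simp add: T.M.a_assoc T.M.l_neg)
    then show "Y \<in> (\<Union>t\<in>carrier T. \<Union>t'\<in>carrier T.
        {mat_add T m n (mat_corner T m n (t' \<oplus>\<^bsub>T\<^esub> t \<oplus>\<^bsub>T\<^esub> ?s)) (X ?gh)})"
      using t s by (intro UN_I[of "t \<oplus>\<^bsub>T\<^esub> \<ominus>\<^bsub>T\<^esub> ?s"] UN_I[of "\<zero>\<^bsub>T\<^esub>"]) auto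
  qed (use s in \<open>auto simp: coset_eq\<close>)
  finally show "\<rho> ?gh = \<rho> g \<otimes>\<^bsub>calU' R T a b\<^esub> act (calU' R T a b) g (\<rho> h)"
    by (simp add: \<rho>_eq[OF gh] block'_def)
qed

end

theorem theorem3p10:
  fixes G :: "'g tgroup" and R :: "'r tring" and T :: "('g, 'r, 't) rgmod"
    and a b :: nat
    and \<phi> \<theta> :: "'g \<Rightarrow> nat \<times> nat \<Rightarrow> 'r"
    and \<alpha> \<beta> :: "nat \<Rightarrow> 'g \<Rightarrow> 'r"
    and \<kappa>' :: "'g \<Rightarrow> (nat \<times> nat \<Rightarrow> 't) set"
    and \<rho> :: "'g \<Rightarrow> ('r, 't) block set"
  assumes "profinite_cring R"
    and "profinite_group G"
    and "compact_RG_module G R T"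
    and "fin_gen_module R T"
    and "a + b \<ge> 2"
    and "partial_defining_system G R a b \<phi> \<theta>"
    and "\<And>i g. i \<in> {1..a} \<Longrightarrow> g \<in> carrier G \<Longrightarrow> \<alpha> i g = \<phi> g (i, i + 1)"
    and "\<And>i g. i \<in> {1..b} \<Longrightarrow> g \<in> carrier G \<Longrightarrow> \<beta> i g = \<theta> g (i, i + 1)"
    and "\<kappa>' \<in> carrier (Z1 G (frakU' R T a b \<phi> \<theta>))"
    and "\<And>g. g \<in> carrier G \<Longrightarrow>
           \<rho> g = block' (\<phi> g) ((\<lambda>X. mat_rmult T (a + 1) (b + 1) X (\<theta> g)) ` \<kappa>' g) (\<theta> g)"
  shows "proper_defining_system G R T a b \<phi> \<theta> \<rho> \<and>
         massey_arguments G T a b \<rho> \<alpha> (\<lambda>g. quot_entry (\<kappa>' g) (a + 1) 1) \<beta> \<and>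
         connecting G (gmod_of T) (frakU R T a b \<phi> \<theta>) (frakU' R T a b \<phi> \<theta>)
             (frakU_incl T a b) (frakU_proj R T a b \<phi> \<theta>)
             (class1 G (frakU' R T a b \<phi> \<theta>) \<kappa>') =
           massey_product G T a b \<rho>"
proof -
  interpret massey_system G R T a b \<phi> \<theta> \<kappa>' \<rho>
    using assms by unfold_locales auto
  have "X g (a + 1, 1) = quot_entry (\<kappa>' g) (a + 1) 1" if g: "g \<in> carrier G" for g
  proof -
    \<comment> \<open>The entry just above the diagonal between the two blocks is the lower left one
      of the upper right block. It must avoid the corner for \<open>quot_entry\<close> to read it
      off a class modulo \<open>T\<close>; the two coincide only if a = b = 0.\<close>
    have "(a + 1, 1) \<noteq> (1, b + 1)"
      using assms(5) by auto
    then show ?thesis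
      using X_first_column[OF g, of "a + 1"] quot_entry_coset[OF \<kappa>_closed[OF g], of "a + 1" 1]
        coset_\<kappa>[OF g] by simp
  qed
  then have "massey_arguments G T a b \<rho> \<alpha> (\<lambda>g. quot_entry (\<kappa>' g) (a + 1) 1) \<beta>"
    using assms(7,8) by (simp add: massey_arguments_def lift_\<rho>)
  then show ?thesis
    using proper connecting_eq_massey by blast
qed

end
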